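(* Let $Z_1,Z_2,\ldots$ be i.i.d. real random variables with distribution $P_0$. Suppose $\mathcal{G}$ is a class of right-continuous functions $g:\mathbb{R}\to\mathbb{R}$ such that $\sup_{g\in\mathcal{G}}|g|_{BV}<\infty$. Then for every $t\in\mathbb{R}$, for $P_0^\infty$-almost every sequence $Z_1,Z_2,\ldots$, as $n\to\infty$, $$\sup_{g\in \mathcal{G}}\left| \mathrm{E}\bigl[e^{t\sqrt{n}(P_ng-\mathbb{P}_ng)} \,\big|\, Z_1,\ldots,Z_n\bigr] - e^{t^2 P_0(g-P_0g)^2/2} \right| \to 0.$$
   Context: $\mathbb{P}_n=n^{-1}\sum_{i=1}^n\delta_{Z_i}$ is the empirical measure, $\nu$ is a finite measure on $\mathbb{R}$ ($\nu=0$ allowed), and given $Z_1,\ldots,Z_n$ the random probability measure $P_n$ is a draw from the Dirichlet process $\mathrm{DP}(\nu+n\mathbb{P}_n)$ with base measure $\nu+n\mathbb{P}_n$. For a measure $\mu$ and function $g$, $\mu g=\int g\,d\mu$. For $f:\mathbb{R}\to\mathbb{R}$ and $a\le b$, $V_a^b(f)=\sup\sum_{i=1}^{m}|f(x_i)-f(x_{i-1})|$, the supremum being over all $m\in\mathbb{N}$ and all partitions $a=x_0\le x_1\le\cdots\le x_m=b$, and $|f|_{BV}=\sup_{a\le b}V_a^b(f)$. *)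

theory Defs
  imports "HOL-Probability.Probability"
begin

definition variation_on :: "real \<Rightarrow> real \<Rightarrow> (real \<Rightarrow> real) \<Rightarrow> ennreal" where
  "variation_on a b f =
     (SUP (m, x) \<in> {(m :: nat, x :: nat \<Rightarrow> real).
                       x 0 = a \<and> x m = b \<and> (\<forall>i\<in>{1..m}. x (i - 1) \<le> x i)}.
        ennreal (\<Sum>i = 1..m. \<bar>f (x i) - f (x (i - 1))\<bar>))"

definition BV_seminorm :: "(real \<Rightarrow> real) \<Rightarrow> ennreal" where
  "BV_seminorm f = (SUP (a, b) \<in> {(a, b). a \<le> b}. variation_on a b f)"

definition empirical_measure :: "nat \<Rightarrow> (nat \<Rightarrow> real) \<Rightarrow> real measure" where
  "empirical_measure n z = distr (uniform_count_measure {..<n}) borel z"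

definition add_measure :: "'a measure \<Rightarrow> 'a measure \<Rightarrow> 'a measure" where
  "add_measure M N = measure_of (space M) (sets M) (\<lambda>A. emeasure M A + emeasure N A)"

lemma sets_add_measure [simp, measurable_cong]: "sets (add_measure M N) = sets M"
  by (simp add: add_measure_def sets.sigma_sets_eq)

lemma space_add_measure [simp]: "space (add_measure M N) = space M"
  by (simp add: add_measure_def)

lemma emeasure_add_measure:
  assumes "sets N = sets M" "A \<in> sets M"
  shows "emeasure (add_measure M N) A = emeasure M A + emeasure N A"
  unfolding add_measure_def
proof (rule emeasure_measure_of_sigma)
  show "sigma_algebra (space M) (sets M)" ..
  show "positive (sets M) (\<lambda>A. emeasure M A + emeasure N A)"
    by (simp add: positive_def)
  show "countably_additive (sets M) (\<lambda>A. emeasure M A + emeasure N A)"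
  proof (rule countably_additiveI)
    fix B :: "nat \<Rightarrow> 'a set"
    assume B: "range B \<subseteq> sets M" "disjoint_family B"
    then have "(\<Sum>i. emeasure M (B i) + emeasure N (B i)) =
        (\<Sum>i. emeasure M (B i)) + (\<Sum>i. emeasure N (B i))"
      by (intro suminf_add[symmetric] summableI)
    with B assms(1) show "(\<Sum>i. emeasure M (B i) + emeasure N (B i)) =
        emeasure M (\<Union> (range B)) + emeasure N (\<Union> (range B))"
      by (simp add: suminf_emeasure)
  qed
qed fact

lemma integral_empirical_measure:
  fixes g :: "real \<Rightarrow> real"
  assumes "g \<in> borel_measurable borel" "n \<ge> 1"
  shows "(\<integral>x. g x \<partial>empirical_measure n z) = (\<Sum>i<n. g (z i)) / real n"
proof -
  have z: "z \<in> uniform_count_measure {..<n} \<rightarrow>\<^sub>M borel"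
    by (simp add: uniform_count_measure_def measurable_def space_point_measure sets_point_measure)
  have "(\<integral>x. g x \<partial>empirical_measure n z) = (\<integral>i. g (z i) \<partial>uniform_count_measure {..<n})"
    unfolding empirical_measure_def by (rule integral_distr[OF z assms(1)])
  also have "\<dots> = (\<Sum>i<n. g (z i)) / real n"
    unfolding uniform_count_measure_def
    by (subst lebesgue_integral_point_measure_finite)
       (simp_all add: sum_divide_distrib)
  finally show ?thesis .
qed

text \<open>
  The gamma distribution with shape \<open>a \<ge> 0\<close> and scale \<open>1\<close>; shape \<open>0\<close> is the point mass at \<open>0\<close>.
\<close>

definition gamma_distr :: "real \<Rightarrow> real measure" where
  "gamma_distr a =
     (if a = 0 then return borel 0
      else density lborel
             (\<lambda>x. ennreal (if 0 < x then x powr (a - 1) * exp (- x) / Gamma a else 0)))"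

text \<open>
  The Dirichlet distribution as defined by Ferguson (1973): the law of
  \<open>(Y\<^sub>i / (\<Sum>j. Y\<^sub>j))\<^sub>i\<close> for independent \<open>Y\<^sub>i\<close> with gamma distributions of shapes \<open>\<alpha>\<^sub>i\<close>.
  Parameters may be zero, with the corresponding coordinates equal to zero, as long as at least
  one of them is positive.
\<close>

definition dirichlet_distr :: "nat \<Rightarrow> (nat \<Rightarrow> real) \<Rightarrow> (nat \<Rightarrow> real) measure" where
  "dirichlet_distr k \<alpha> =
     distr (\<Pi>\<^sub>M i\<in>{..<k}. gamma_distr (\<alpha> i)) (\<Pi>\<^sub>M i\<in>{..<k}. borel)
       (\<lambda>y. \<lambda>i\<in>{..<k}. y i / (\<Sum>j<k. y j))"

text \<open>
  \<open>is_dirichlet_process \<alpha> D\<close>: the law \<open>D\<close>, on the space of Borel probability measures on the line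
  with the \<open>\<sigma>\<close>-algebra generated by the evaluations \<open>P \<mapsto> P A\<close>, is the Dirichlet process with
  base measure \<open>\<alpha>\<close>. On this \<open>\<sigma>\<close>-algebra the condition determines \<open>D\<close> uniquely.
\<close>

definition is_dirichlet_process :: "real measure \<Rightarrow> real measure measure \<Rightarrow> bool" where
  "is_dirichlet_process \<alpha> D \<longleftrightarrow>
     D \<in> space (prob_algebra (prob_algebra borel)) \<and>
     (\<forall>k (A :: nat \<Rightarrow> real set).
        (\<forall>i<k. A i \<in> sets borel) \<and> disjoint_family_on A {..<k} \<and> (\<Union>i<k. A i) = UNIV \<longrightarrow>
        distr D (\<Pi>\<^sub>M i\<in>{..<k}. borel) (\<lambda>P. \<lambda>i\<in>{..<k}. measure P (A i)) =
          dirichlet_distr k (\<lambda>i. measure \<alpha> (A i)))"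

definition posterior_base :: "real measure \<Rightarrow> nat \<Rightarrow> (nat \<Rightarrow> real) \<Rightarrow> real measure" where
  "posterior_base \<nu> n z = add_measure \<nu> (scale_measure (of_nat n) (empirical_measure n z))"

end

theory Submission
  imports Defs "HOL-Real_Asymp.Real_Asymp"
begin

text \<open>
  Given the sample, \<open>P\<close> is a Dirichlet process whose base measure has total mass \<open>N = n + \<bar>\<nu>\<bar>\<close>. On a
  finite partition it is a vector \<open>Y i / W\<close> with independent gamma variables \<open>Y i\<close> and \<open>W = (\<Sum>j. Y j)\<close>.
  If \<open>W\<close> is replaced by its mean \<open>N\<close>, the Laplace transform of the integral of a simple function \<open>h\<close> at
  \<open>s = t * sqrt n\<close> becomes a product of gamma Laplace transforms, \<open>exp (- \<integral>ln (1 - s / N * h) d\<alpha>)\<close>, where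
  \<open>\<alpha>\<close> is the base measure. Its second-order expansion is \<open>exp (s / N * \<alpha> h + (s / N)\<^sup>2 * \<alpha> (h\<^sup>2) / 2)\<close>. For
  \<open>h = g - \<mu> g\<close>, with \<open>\<mu>\<close> the empirical measure, the linear term only sees \<open>\<nu>\<close> and is of order \<open>1 / sqrt n\<close>,
  while the quadratic one is close to \<open>t\<^sup>2 / 2\<close> times the empirical variance of \<open>g\<close>.

  Replacing \<open>W\<close> by \<open>N\<close> is justified without computing the joint law of \<open>W\<close> and \<open>P\<close>. The two
  exponents differ by a factor \<open>W / N\<close>, which is within \<open>\<delta>\<close> of \<open>1\<close> except on an event of probability at
  most \<open>2 * exp (- N * \<delta>\<^sup>2 / 8)\<close> (Chernoff). On that event the original exponential is at most
  \<open>exp (C * sqrt n)\<close> for a constant \<open>C\<close>, which the exponentially small probability absorbs for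
  \<open>\<delta> = n powr (- 1 / 8)\<close>. The pointwise form of this argument is \<open>exp_self_normalised_le\<close>; it leads to
  \<open>dirichlet_laplace\<close> for vectors and, by approximation with simple functions, to
  \<open>dirichlet_process_laplace\<close>. All constants depend on \<open>g\<close> only through a bound for its oscillation, so the
  estimate is uniform over \<open>G\<close>.

  It remains to replace the empirical variance by the variance under \<open>P0\<close>, uniformly over \<open>G\<close>. A
  function \<open>g\<close> of variation at most \<open>K\<close> has an increasing majorant \<open>v\<close> with values in \<open>[0, K]\<close> and
  \<open>\<bar>g y - g x\<bar> \<le> v y - v x\<close> for \<open>x \<le> y\<close> (\<open>BV_majorant\<close>). Hence \<open>g\<close>, and likewise its square after
  subtracting the value at \<open>0\<close>, is a difference of bounded increasing functions, and its integrals under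
  two probability measures differ by at most a constant times their Kolmogorov--Smirnov distance
  (\<open>integral_majorant_ks\<close>, \<open>variance_ks\<close>). For the empirical measure this distance tends to \<open>0\<close> almost
  surely by the Glivenko--Cantelli theorem (\<open>glivenko_cantelli\<close>). The exceptional null set there is the
  only one, and it does not depend on \<open>g\<close>.
\<close>

section \<open>Functions of bounded variation\<close>

lemma partition_sum_le:
  fixes f :: "real \<Rightarrow> real" and p :: "nat \<Rightarrow> real"
  assumes f: "BV_seminorm f \<le> ennreal K" and K: "0 \<le> K"
    and p: "\<forall>i\<in>{1..m}. p (i - 1) \<le> p i"
  shows "(\<Sum>i = 1..m. \<bar>f (p i) - f (p (i - 1))\<bar>) \<le> K"
proof -
  have le: "j \<le> m \<Longrightarrow> p 0 \<le> p j" for j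
  proof (induction j)
    case (Suc j)
    then show ?case using p[rule_format, of "Suc j"] by simp
  qed simp
  have "ennreal (\<Sum>i = 1..m. \<bar>f (p i) - f (p (i - 1))\<bar>) \<le> variation_on (p 0) (p m) f"
    unfolding variation_on_def by (rule SUP_upper2[where i = "(m, p)"]) (use p in auto)
  also have "\<dots> \<le> BV_seminorm f"
    unfolding BV_seminorm_def by (rule SUP_upper2[where i = "(p 0, p m)"]) (use le in auto)
  also have "\<dots> \<le> ennreal K" by fact
  finally show ?thesis using K by simp
qed

text \<open>
  The variation of \<open>f\<close> on \<open>(-\<infinity>, x]\<close>, as a function of \<open>x\<close>. Appending the point \<open>y\<close> to a partition
  that ends in \<open>x\<close> adds \<open>\<bar>f y - f x\<bar>\<close> to its sum, so this function increases at least as fast as \<open>f\<close>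
  oscillates. Below, the class \<open>G\<close> enters only through such majorants.
\<close>

lemma BV_majorant:
  fixes f :: "real \<Rightarrow> real"
  assumes f: "BV_seminorm f \<le> ennreal K" and K: "0 \<le> K"
  obtains v :: "real \<Rightarrow> real" where "\<And>x. 0 \<le> v x" "\<And>x. v x \<le> K"
    "\<And>x y. x \<le> y \<Longrightarrow> \<bar>f y - f x\<bar> \<le> v y - v x"
proof -
  define S where "S x = {(\<Sum>i = 1..m. \<bar>f (p i) - f (p (i - 1))\<bar>) | (m :: nat) (p :: nat \<Rightarrow> real).
    p m = x \<and> (\<forall>i\<in>{1..m}. p (i - 1) \<le> p i)}" for x :: real
  define v where "v x = Sup (S x)" for x
  have S_le: "s \<le> K" if "s \<in> S x" for s x
  proof -
    from that obtain m :: nat and p :: "nat \<Rightarrow> real" where "s = (\<Sum>i = 1..m. \<bar>f (p i) - f (p (i - 1))\<bar>)"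
      "\<forall>i\<in>{1..m}. p (i - 1) \<le> p i" unfolding S_def by blast
    then show ?thesis using partition_sum_le[OF f K, of m p] by simp
  qed
  have S_0: "0 \<in> S x" for x
    unfolding S_def by (rule CollectI, rule exI[of _ 0], rule exI[of _ "\<lambda>_. x"]) simp
  have bdd: "bdd_above (S x)" for x
    using S_le by (meson bdd_above.I)
  have S_ext: "s + \<bar>f y - f x\<bar> \<in> S y" if "s \<in> S x" "x \<le> y" for s x y
  proof -
    from that obtain m :: nat and p :: "nat \<Rightarrow> real" where s: "s = (\<Sum>i = 1..m. \<bar>f (p i) - f (p (i - 1))\<bar>)" "p m = x"
      and p: "\<forall>i\<in>{1..m}. p (i - 1) \<le> p i" unfolding S_def by blast
    let ?q = "p(Suc m := y)"
    have q1: "(\<Sum>i = 1..Suc m. \<bar>f (?q i) - f (?q (i - 1))\<bar>) = s + \<bar>f y - f x\<bar>"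
      using s by (auto intro!: sum.cong)
    have q2: "\<forall>i\<in>{1..Suc m}. ?q (i - 1) \<le> ?q i"
      using p s that(2) by (auto simp: le_Suc_eq)
    have q3: "?q (Suc m) = y" by simp
    show ?thesis
      unfolding S_def
      by (intro CollectI exI[of _ "Suc m"] exI[of _ ?q] conjI) (rule q1[symmetric] q2 q3)+
  qed
  show thesis
  proof (rule that[of v])
    show "0 \<le> v x" for x
      unfolding v_def by (rule cSup_upper[OF S_0 bdd])
    show "v x \<le> K" for x
      unfolding v_def by (rule cSup_least) (use S_0 S_le in blast)+
    show "\<bar>f y - f x\<bar> \<le> v y - v x" if "x \<le> y" for x y
    proof -
      have "v x \<le> v y - \<bar>f y - f x\<bar>"
        unfolding v_def
      proof (rule cSup_least)
        fix s assume "s \<in> S x"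
        from cSup_upper[OF S_ext[OF this that] bdd]
        show "s \<le> Sup (S y) - \<bar>f y - f x\<bar>" by simp
      qed (use S_0 in blast)
      then show ?thesis by simp
    qed
  qed
qed

section \<open>The Kolmogorov--Smirnov distance and functions of bounded variation\<close>

text \<open>
  The indicators of the upper sets are the extreme monotone functions into \<open>[0, 1]\<close>. Uniform
  closeness is measured on all of them, open and closed half-lines alike, so that monotone
  functions with jumps of either kind are covered.
\<close>

definition upset :: "real set \<Rightarrow> bool" where
  "upset U \<longleftrightarrow> (\<forall>x\<in>U. \<forall>y\<ge>x. y \<in> U)"

lemma upset_borel:
  assumes "upset U" shows "U \<in> sets borel"
proof -
  have "mono (indicator U :: real \<Rightarrow> real)"
    using assms by (auto simp: mono_def upset_def indicator_def)
  then have "(indicator U :: real \<Rightarrow> real) \<in> borel_measurable borel"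
    by (rule borel_measurable_mono)
  then show ?thesis by (simp add: borel_measurable_indicator_iff)
qed

definition ks_distance :: "real measure \<Rightarrow> real measure \<Rightarrow> real" where
  "ks_distance \<mu> \<pi> = (SUP U\<in>Collect upset. \<bar>measure \<mu> U - measure \<pi> U\<bar>)"

lemma ks_distance_upper:
  assumes "prob_space \<mu>" "prob_space \<pi>" "upset U"
  shows "\<bar>measure \<mu> U - measure \<pi> U\<bar> \<le> ks_distance \<mu> \<pi>"
proof -
  have "\<bar>measure \<mu> V - measure \<pi> V\<bar> \<le> 1" for V
    using prob_space.prob_le_1[OF assms(1), of V] prob_space.prob_le_1[OF assms(2), of V]
      measure_nonneg[of \<mu> V] measure_nonneg[of \<pi> V] by linarith
  then show ?thesis
    unfolding ks_distance_def using assms(3)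
    by (intro cSUP_upper bdd_aboveI[of _ 1]) auto
qed

lemma ks_distance_least:
  assumes "\<And>U. upset U \<Longrightarrow> \<bar>measure \<mu> U - measure \<pi> U\<bar> \<le> d"
  shows "ks_distance \<mu> \<pi> \<le> d"
  unfolding ks_distance_def
proof (rule cSUP_least)
  show "Collect upset \<noteq> {}" by (auto intro!: exI[of _ "{}"] simp: upset_def)
qed (use assms in auto)

lemma ks_distance_nonneg:
  assumes "prob_space \<mu>" "prob_space \<pi>"
  shows "0 \<le> ks_distance \<mu> \<pi>"
  using ks_distance_upper[OF assms, of "{}"] by (simp add: upset_def)

text \<open>
  A number is, up to an error of at most \<open>1\<close>, the number of integer levels below it. Applied to
  \<open>k * v x\<close> this writes a monotone \<open>v\<close> as an average of indicators of upper sets.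
\<close>

lemma floor_layer_cake:
  fixes y :: real
  assumes "0 \<le> y" "y \<le> real k"
  shows "real_of_int \<lfloor>y\<rfloor> = (\<Sum>i = 1..k. indicator {u. real i \<le> u} y)"
proof -
  have "(\<Sum>i = 1..k. indicator {u. real i \<le> u} y) = real (card {i \<in> {1..k}. real i \<le> y})"
    by (simp add: indicator_def sum.If_cases Int_def)
  also have "{i \<in> {1..k}. real i \<le> y} = {1..nat \<lfloor>y\<rfloor>}"
    using assms by (auto simp: le_nat_floor le_floor_iff nat_le_iff) linarith+
  finally show ?thesis using assms by simp
qed

text \<open>
  By the layer-cake decomposition, \<open>v\<close> is within \<open>1 / k\<close> of the average of the indicators of the
  upper sets \<open>{x. i \<le> k * v x}\<close>, \<open>1 \<le> i \<le> k\<close>; each of them contributes at most the distance. Let \<open>k\<close>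
  grow.
\<close>

lemma integral_mono_ks:
  fixes v :: "real \<Rightarrow> real"
  assumes \<mu>: "prob_space \<mu>" "sets \<mu> = sets borel" and \<pi>: "prob_space \<pi>" "sets \<pi> = sets borel"
    and v: "mono v" "\<And>x. 0 \<le> v x" "\<And>x. v x \<le> 1"
  shows "\<bar>(\<integral>x. v x \<partial>\<mu>) - (\<integral>x. v x \<partial>\<pi>)\<bar> \<le> ks_distance \<mu> \<pi>"
proof -
  note [measurable] = borel_measurable_mono[OF v(1)]
  note [measurable_cong] = \<mu>(2) \<pi>(2)
  define U where "U k i = {x. real i \<le> real k * v x}" for k i :: nat
  have U: "upset (U k i)" for k i
    using v(1) by (auto simp: upset_def U_def mono_def) (meson order_trans mult_left_mono of_nat_0_le_iff)
  have approx: "\<bar>(\<integral>x. v x \<partial>\<rho>) - (\<Sum>i = 1..k. measure \<rho> (U k i)) / real k\<bar> \<le> 1 / real k"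
    if \<rho>: "prob_space \<rho>" "sets \<rho> = sets borel" and k: "k > 0" for k :: nat and \<rho>
  proof -
    interpret prob_space \<rho> by fact
    note [measurable_cong] = \<rho>(2)
    have [simp]: "space \<rho> = UNIV" using sets_eq_imp_space_eq[OF \<rho>(2)] by simp
    have iv: "integrable \<rho> v"
      by (rule integrable_const_bound[of _ 1]) (use v in auto)
    have [measurable]: "U k i \<in> sets \<rho>" for i using upset_borel[OF U] \<rho> by simp
    have [simp]: "integrable \<rho> (indicat_real (U k i))" for i
      by (auto intro!: integrable_real_indicator simp: less_top[symmetric])
    have "(\<Sum>i = 1..k. measure \<rho> (U k i)) / real k = (\<integral>x. (\<Sum>i = 1..k. indicator (U k i) x) / real k \<partial>\<rho>)"
      by (subst integral_divide_zero, subst Bochner_Integration.integral_sum) auto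
    also have "(\<integral>x. v x \<partial>\<rho>) - \<dots> = (\<integral>x. v x - (\<Sum>i = 1..k. indicator (U k i) x) / real k \<partial>\<rho>)"
      by (subst Bochner_Integration.integral_diff) (auto intro!: iv Bochner_Integration.integrable_sum)
    finally have eq: "(\<integral>x. v x \<partial>\<rho>) - (\<Sum>i = 1..k. measure \<rho> (U k i)) / real k =
      (\<integral>x. v x - (\<Sum>i = 1..k. indicator (U k i) x) / real k \<partial>\<rho>)" .
    have pt: "\<bar>v x - (\<Sum>i = 1..k. indicator (U k i) x) / real k\<bar> \<le> 1 / real k" for x
    proof -
      have "(\<Sum>i = 1..k. indicator (U k i) x) = (\<Sum>i = 1..k. indicator {u. real i \<le> u} (real k * v x) :: real)"
        by (intro sum.cong) (auto simp: U_def indicator_def)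
      also have "\<dots> = real_of_int \<lfloor>real k * v x\<rfloor>"
        by (rule floor_layer_cake[symmetric]) (use v in \<open>auto intro: mult_left_le\<close>)
      finally have e: "(\<Sum>i = 1..k. indicator (U k i) x) = real_of_int \<lfloor>real k * v x\<rfloor>" .
      have "\<bar>real k * v x - real_of_int \<lfloor>real k * v x\<rfloor>\<bar> \<le> 1" by linarith
      moreover have "v x - real_of_int \<lfloor>real k * v x\<rfloor> / real k = (real k * v x - real_of_int \<lfloor>real k * v x\<rfloor>) / real k"
        using k by (simp add: field_simps)
      ultimately show ?thesis unfolding e using k by (simp add: abs_divide divide_right_mono)
    qed
    have "\<bar>\<integral>x. v x - (\<Sum>i = 1..k. indicator (U k i) x) / real k \<partial>\<rho>\<bar> \<le>
        (\<integral>x. \<bar>v x - (\<Sum>i = 1..k. indicator (U k i) x) / real k\<bar> \<partial>\<rho>)"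
      by (rule integral_abs_bound)
    also have "\<dots> \<le> (\<integral>x. 1 / real k \<partial>\<rho>)"
      by (intro integral_mono) (use pt in \<open>auto intro!: iv integrable_abs Bochner_Integration.integrable_diff integrable_divide_zero Bochner_Integration.integrable_sum\<close>)
    also have "\<dots> = 1 / real k" by (simp add: prob_space[simplified])
    finally show ?thesis using eq by simp
  qed
  have "\<bar>(\<integral>x. v x \<partial>\<mu>) - (\<integral>x. v x \<partial>\<pi>)\<bar> \<le> ks_distance \<mu> \<pi> + 2 / real k" if k: "k > 0" for k :: nat
  proof -
    have "\<bar>(\<Sum>i = 1..k. measure \<mu> (U k i)) - (\<Sum>i = 1..k. measure \<pi> (U k i))\<bar> \<le>
        (\<Sum>i = 1..k. \<bar>measure \<mu> (U k i) - measure \<pi> (U k i)\<bar>)"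
      unfolding sum_subtractf[symmetric] by (rule sum_abs)
    also have "\<dots> \<le> (\<Sum>i = 1..k. ks_distance \<mu> \<pi>)"
      by (intro sum_mono ks_distance_upper \<mu> \<pi> U)
    finally have "\<bar>(\<Sum>i = 1..k. measure \<mu> (U k i)) - (\<Sum>i = 1..k. measure \<pi> (U k i))\<bar> \<le> real k * ks_distance \<mu> \<pi>"
      by simp
    then have "\<bar>(\<Sum>i = 1..k. measure \<mu> (U k i)) / real k - (\<Sum>i = 1..k. measure \<pi> (U k i)) / real k\<bar> \<le> ks_distance \<mu> \<pi>"
      using k unfolding diff_divide_distrib[symmetric] abs_divide by (simp add: field_simps)
    with approx[OF \<mu> k] approx[OF \<pi> k] show ?thesis by (simp add: abs_le_iff; linarith)
  qed
  moreover have "(\<lambda>k. ks_distance \<mu> \<pi> + 2 / real k) \<longlonglongrightarrow> ks_distance \<mu> \<pi> + 0"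
    by (intro tendsto_intros real_tendsto_divide_at_top filterlim_real_sequentially)
  ultimately show ?thesis
    by (intro LIMSEQ_le_const[of "\<lambda>k. ks_distance \<mu> \<pi> + 2 / real k"]) (auto intro!: exI[of _ 1])
qed

lemma measurable_of_majorant:
  fixes h v :: "real \<Rightarrow> real"
  assumes hv: "\<And>x y. x \<le> y \<Longrightarrow> \<bar>h y - h x\<bar> \<le> v y - v x"
  shows "h \<in> borel_measurable borel"
proof -
  have "mono (\<lambda>x. h x + v x)" "mono v"
    using hv by (auto simp: mono_def abs_le_iff) (smt (verit))+
  from this[THEN borel_measurable_mono] have "(\<lambda>x. (h x + v x) - v x) \<in> borel_measurable borel"
    by (rule borel_measurable_diff)
  then show ?thesis by simp
qed

text \<open>
  Jordan decomposition: \<open>h = (h + v) - v\<close> is a difference of two increasing functions. Rescaled to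
  \<open>[0, 1]\<close>, they have ranges of lengths \<open>3 * C\<close> and \<open>C\<close>, which gives the factor \<open>4\<close>.
\<close>

lemma integral_majorant_ks:
  fixes h v :: "real \<Rightarrow> real"
  assumes \<mu>: "prob_space \<mu>" "sets \<mu> = sets borel" and \<pi>: "prob_space \<pi>" "sets \<pi> = sets borel"
    and v: "\<And>x. 0 \<le> v x" "\<And>x. v x \<le> C"
    and hv: "\<And>x y. x \<le> y \<Longrightarrow> \<bar>h y - h x\<bar> \<le> v y - v x"
    and h: "\<And>x. \<bar>h x\<bar> \<le> C"
  shows "\<bar>(\<integral>x. h x \<partial>\<mu>) - (\<integral>x. h x \<partial>\<pi>)\<bar> \<le> 4 * C * ks_distance \<mu> \<pi>"
proof (cases "C = 0")
  case True
  then show ?thesis using h by simp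
next
  case False
  with v[of 0] have C: "C > 0" by linarith
  note [measurable] = measurable_of_majorant[OF hv]
  have mv: "mono v" using hv by (auto simp: mono_def) (smt (verit))
  note [measurable] = borel_measurable_mono[OF mv]
  define p where "p x = (h x + v x + C) / (3 * C)" for x
  define q where "q x = v x / C" for x
  have mp: "mono p"
  proof (rule monoI)
    fix x y :: real assume "x \<le> y"
    with hv[of x y] have "h x + v x \<le> h y + v y" by linarith
    then show "p x \<le> p y" using C by (simp add: p_def divide_right_mono)
  qed
  have mq: "mono q" using mv C by (auto simp: q_def mono_def divide_right_mono)
  have p01: "0 \<le> p x" "p x \<le> 1" for x
    using h[of x] v[of x] C by (auto simp: p_def abs_le_iff)
  have q01: "0 \<le> q x" "q x \<le> 1" for x
    using v[of x] C by (auto simp: q_def)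
  have eq: "(\<integral>x. h x \<partial>\<rho>) = 3 * C * (\<integral>x. p x \<partial>\<rho>) - C * (\<integral>x. q x \<partial>\<rho>) - C"
    if \<rho>: "prob_space \<rho>" "sets \<rho> = sets borel" for \<rho>
  proof -
    interpret prob_space \<rho> by fact
    note [measurable_cong] = \<rho>(2)
    have [measurable]: "p \<in> borel_measurable borel" "q \<in> borel_measurable borel"
      unfolding p_def q_def by measurable
    have [simp]: "integrable \<rho> p" "integrable \<rho> q"
      using p01 q01 by (auto intro!: integrable_const_bound[of _ 1])
    have "h x = 3 * C * p x - C * q x - C" for x
      using C by (simp add: p_def q_def)
    then have "(\<integral>x. h x \<partial>\<rho>) = (\<integral>x. 3 * C * p x - C * q x - C \<partial>\<rho>)" by simp
    also have "\<dots> = 3 * C * (\<integral>x. p x \<partial>\<rho>) - C * (\<integral>x. q x \<partial>\<rho>) - C"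
      by (simp add: prob_space)
    finally show ?thesis .
  qed
  have "\<bar>(\<integral>x. p x \<partial>\<mu>) - (\<integral>x. p x \<partial>\<pi>)\<bar> \<le> ks_distance \<mu> \<pi>"
    by (rule integral_mono_ks[OF \<mu> \<pi> mp p01])
  moreover have "\<bar>(\<integral>x. q x \<partial>\<mu>) - (\<integral>x. q x \<partial>\<pi>)\<bar> \<le> ks_distance \<mu> \<pi>"
    by (rule integral_mono_ks[OF \<mu> \<pi> mq q01])
  ultimately have "\<bar>3 * C * ((\<integral>x. p x \<partial>\<mu>) - (\<integral>x. p x \<partial>\<pi>)) - C * ((\<integral>x. q x \<partial>\<mu>) - (\<integral>x. q x \<partial>\<pi>))\<bar>
      \<le> 3 * C * ks_distance \<mu> \<pi> + C * ks_distance \<mu> \<pi>"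
    using C by (intro order_trans[OF abs_triangle_ineq4] add_mono) (auto simp: abs_mult)
  then show ?thesis unfolding eq[OF \<mu>] eq[OF \<pi>] by (simp add: algebra_simps)
qed

section \<open>Uniform convergence of the empirical measure\<close>

text \<open>
  Let \<open>q j\<close> be the quantile of \<open>\<pi>\<close> at level \<open>j / k\<close>. If \<open>j\<close> is the first index whose quantile lies in
  an upper set \<open>U\<close>, then \<open>U\<close> contains the half-line from \<open>q j\<close> on and is contained in the open
  half-line beyond \<open>q (j - 1)\<close>, and what lies strictly between two consecutive quantiles has mass at
  most \<open>1 / k\<close>. Finitely many sets thus control all upper sets.
\<close>

lemma upset_brackets:
  assumes \<pi>: "prob_space \<pi>" "sets \<pi> = sets borel" and k: "k > (0::nat)"
  obtains A B :: "nat \<Rightarrow> real set" where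
    "\<And>j. A j \<in> sets borel" "\<And>j. B j \<in> sets borel"
    "\<And>U. upset U \<Longrightarrow> \<exists>j\<le>k. B j \<subseteq> U \<and> U \<subseteq> A j \<and> measure \<pi> (A j) - measure \<pi> (B j) \<le> 1 / real k"
proof -
  interpret \<pi>: cdf_distribution \<pi>
    using \<pi> by (simp add: cdf_distribution_def real_distribution_def real_distribution_axioms_def)
  define q where "q j = \<pi>.I (real j / real k)" for j
  have q: "real j / real k \<le> measure \<pi> {..x} \<longleftrightarrow> q j \<le> x" if "0 < j" "j < k" for j x
    using \<pi>.pseudoinverse[of "real j / real k" x] that by (simp add: cdf_def q_def)
  have q_le: "measure \<pi> {..<q j} \<le> real j / real k" if "0 < j" "j < k" for j
  proof (rule tendsto_upperbound[OF \<pi>.cdf_at_left])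
    have "cdf \<pi> x \<le> real j / real k" if "x < q j" for x
      using q[OF \<open>0 < j\<close> \<open>j < k\<close>, of x] that by (simp add: cdf_def)
    then show "eventually (\<lambda>x. cdf \<pi> x \<le> real j / real k) (at_left (q j))"
      by (auto simp: eventually_at_filter)
  qed simp
  \<comment> \<open>\<open>q\<close> is meaningful only strictly between \<open>0\<close> and \<open>k\<close>; \<open>UNIV\<close> and \<open>{}\<close> take the places of the
    half-lines that start at minus and plus infinity.\<close>
  define A where "A j = (if j \<le> 1 then UNIV else {q (j - 1)<..})" for j
  define B where "B j = (if j \<ge> k then {} else {q j..})" for j
  have mA: "measure \<pi> (A j) \<le> 1 - (real j - 1) / real k" if "0 < j" "j \<le> k" for j
  proof (cases "j \<le> 1")
    case True
    with that have "j = 1" by simp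
    then show ?thesis by simp
  next
    case False
    have "{q (j - 1)<..} = space \<pi> - {..q (j - 1)}" by auto
    then have "measure \<pi> {q (j - 1)<..} = 1 - measure \<pi> {..q (j - 1)}"
      by (simp add: \<pi>.prob_compl[simplified])
    then show ?thesis
      using False that q[of "j - 1" "q (j - 1)"] by (simp add: A_def of_nat_diff)
  qed
  have mB: "1 - real j / real k \<le> measure \<pi> (B j)" if "0 < j" "j \<le> k" for j
  proof (cases "j \<ge> k")
    case True
    then show ?thesis using that by simp
  next
    case False
    have "{q j..} = space \<pi> - {..<q j}" by auto
    then have "measure \<pi> {q j..} = 1 - measure \<pi> {..<q j}"
      by (simp add: \<pi>.prob_compl[simplified])
    then show ?thesis using False that q_le[of j] by (simp add: B_def)
  qed
  show thesis
  proof (rule that[of A B])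
    fix U assume U: "upset U"
    define j where "j = (LEAST j. 0 < j \<and> (j = k \<or> q j \<in> U))"
    have j: "0 < j" "j = k \<or> q j \<in> U" "j \<le> k"
      using LeastI[of "\<lambda>j. 0 < j \<and> (j = k \<or> q j \<in> U)" k] k
        Least_le[of "\<lambda>j. 0 < j \<and> (j = k \<or> q j \<in> U)" k] by (auto simp: j_def)
    have min: "q (j - 1) \<notin> U" if "1 < j"
      using not_less_Least[of "j - 1" "\<lambda>j. 0 < j \<and> (j = k \<or> q j \<in> U)"] that
      unfolding j_def[symmetric] by auto
    have "B j \<subseteq> U" using j U by (auto simp: B_def upset_def)
    moreover have "U \<subseteq> A j"
    proof
      fix x assume "x \<in> U"
      with min U have "q (j - 1) < x" if "1 < j"
        using that unfolding upset_def by (meson not_less)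
      then show "x \<in> A j" by (simp add: A_def)
    qed
    moreover have "measure \<pi> (A j) - measure \<pi> (B j) \<le> 1 / real k"
      using mA[of j] mB[of j] j by (simp add: field_simps)
    ultimately show "\<exists>j\<le>k. B j \<subseteq> U \<and> U \<subseteq> A j \<and> measure \<pi> (A j) - measure \<pi> (B j) \<le> 1 / real k"
      using j by blast
  qed (auto simp: A_def B_def)
qed

lemma sets_empirical_measure [simp, measurable_cong]: "sets (empirical_measure n z) = sets borel"
  by (simp add: empirical_measure_def)

lemma prob_space_empirical_measure:
  assumes "n \<ge> 1" shows "prob_space (empirical_measure n z)"
  unfolding empirical_measure_def
  by (intro prob_space.prob_space_distr prob_space_uniform_count_measure)
    (use assms in \<open>auto simp: uniform_count_measure_def measurable_def space_point_measure sets_point_measure lessThan_empty_iff\<close>)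

lemma measure_empirical_measure:
  assumes "n \<ge> 1" "A \<in> sets borel"
  shows "measure (empirical_measure n z) A = (\<Sum>i<n. indicator A (z i)) / real n"
  using integral_empirical_measure[of "indicator A" n z] assms
  by (simp add: sets_eq_imp_space_eq[OF sets_empirical_measure])

text \<open>
  The strong law of large numbers for indicators: Hoeffding's inequality makes the probabilities of
  a deviation by \<open>1 / (k + 1)\<close> summable in the sample size, and the Borel--Cantelli lemma applies for
  each \<open>k\<close>.
\<close>

lemma empirical_measure_tendsto_AE:
  fixes Z :: "nat \<Rightarrow> 'w \<Rightarrow> real"
  assumes M: "prob_space M" and indep: "prob_space.indep_vars M (\<lambda>_. borel) Z UNIV"
    and distr: "\<And>i. distr M borel (Z i) = \<pi>" and A: "A \<in> sets borel"
  shows "AE \<omega> in M. (\<lambda>n. measure (empirical_measure n (\<lambda>i. Z i \<omega>)) A) \<longlonglongrightarrow> measure \<pi> A"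
proof -
  interpret prob_space M by fact
  note [measurable] = A
  have Z[measurable]: "Z i \<in> borel_measurable M" for i
    using indep unfolding indep_vars_def by auto
  define X where "X i \<omega> = (indicator A (Z i \<omega>) :: real)" for i \<omega>
  have [measurable]: "X i \<in> borel_measurable M" for i unfolding X_def by measurable
  have indepX: "indep_vars (\<lambda>_. borel) X UNIV"
  proof -
    have "indep_vars (\<lambda>_. borel) (\<lambda>i. indicator A \<circ> Z i :: 'w \<Rightarrow> real) UNIV"
      by (rule indep_vars_compose[OF indep]) auto
    moreover have "X = (\<lambda>i. indicator A \<circ> Z i)" by (auto simp: X_def fun_eq_iff)
    ultimately show ?thesis by simp
  qed
  have distrX: "distr M borel (X i) = distr M borel (X 0)" for i
  proof -
    have "distr M borel (X i) = distr (distr M borel (Z i)) borel (indicator A)" for i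
      by (subst distr_distr) (auto simp: X_def[abs_def] comp_def)
    then show ?thesis by (simp add: distr)
  qed
  have EX: "expectation (X 0) = measure \<pi> A"
  proof -
    have "expectation (X 0) = (\<integral>x. indicator A x \<partial>distr M borel (Z 0))"
      by (subst integral_distr) (auto simp: X_def[abs_def])
    also have "space \<pi> = UNIV" unfolding distr[of 0, symmetric] by simp
    then have "(\<integral>x. indicator A x \<partial>distr M borel (Z 0)) = measure \<pi> A" by (simp add: distr)
    finally show ?thesis .
  qed
  have iid: "Hoeffding_ineq_iid M {..<n} X (X 0) 0 1" for n
    unfolding Hoeffding_ineq_iid_def iid_interval_bounded_random_variables_def
      iid_interval_bounded_random_variables_axioms_def
    using indep_vars_subset[OF indepX, of "{..<n}"] distrX
    by (auto simp: X_def prob_space_axioms indicator_def)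
  define bad where "bad e n = {\<omega>\<in>space M. \<bar>(\<Sum>i<n. X i \<omega>) / real n - measure \<pi> A\<bar> \<ge> e}" for e :: real and n
  have [measurable]: "bad e n \<in> sets M" for e n unfolding bad_def by measurable
  have "AE \<omega> in M. eventually (\<lambda>n. \<omega> \<in> space M - bad (1 / real (Suc k)) n) sequentially" for k
  proof (rule borel_cantelli_AE1)
    let ?e = "1 / real (Suc k)"
    have s: "summable (\<lambda>n. 2 * exp (- 2 * ?e\<^sup>2) ^ n)"
      by (intro summable_mult summable_geometric) simp
    have p: "prob (bad ?e n) \<le> 2 * exp (- 2 * ?e\<^sup>2) ^ n" for n
    proof (cases "n = 0")
      case True
      then show ?thesis by (simp add: order_trans[OF prob_le_1])
    next
      case False
      have "prob (bad ?e n) \<le> 2 * exp (- 2 * real n * ?e\<^sup>2)"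
        using Hoeffding_ineq_iid.Hoeffding_ineq_abs_ge'[OF iid[of n], of ?e] False EX
        by (simp add: bad_def lessThan_empty_iff)
      also have "\<dots> = 2 * exp (- 2 * ?e\<^sup>2) ^ n"
        by (simp add: exp_of_nat_mult[symmetric] mult_ac)
      finally show ?thesis .
    qed
    show "summable (\<lambda>n. prob (bad ?e n))"
    proof (rule summable_comparison_test'[OF s, of 0])
      show "norm (prob (bad ?e n)) \<le> 2 * exp (- 2 * ?e\<^sup>2) ^ n" for n
        unfolding real_norm_def abs_of_nonneg[OF measure_nonneg] by (rule p)
    qed
  qed (auto simp: less_top[symmetric])
  then have "AE \<omega> in M. \<forall>k. eventually (\<lambda>n. \<omega> \<in> space M - bad (1 / real (Suc k)) n) sequentially"
    by (simp add: AE_all_countable)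
  then show ?thesis
  proof eventually_elim
    case (elim \<omega>)
    show ?case
    proof (rule tendstoI)
      fix e :: real assume "e > 0"
      then obtain k where k: "1 / real (Suc k) < e" using nat_approx_posE by blast
      show "eventually (\<lambda>n. dist (measure (empirical_measure n (\<lambda>i. Z i \<omega>)) A) (measure \<pi> A) < e) sequentially"
        using elim[rule_format, of k] eventually_ge_at_top[of "1::nat"]
      proof eventually_elim
        case (elim n)
        then have "\<bar>(\<Sum>i<n. X i \<omega>) / real n - measure \<pi> A\<bar> < 1 / real (Suc k)"
          by (auto simp: bad_def not_le simp del: of_nat_Suc)
        then show ?case using k elim(2)
          by (simp add: measure_empirical_measure A dist_real_def X_def del: of_nat_Suc)
      qed
    qed
  qed
qed

text \<open>
  Almost surely the law of large numbers holds for the countably many brackets at all levels at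
  once, and for each level the finitely many brackets squeeze every upper set.
\<close>

lemma glivenko_cantelli:
  fixes Z :: "nat \<Rightarrow> 'w \<Rightarrow> real"
  assumes M: "prob_space M" and indep: "prob_space.indep_vars M (\<lambda>_. borel) Z UNIV"
    and distr: "\<And>i. distr M borel (Z i) = \<pi>"
  shows "AE \<omega> in M. (\<lambda>n. ks_distance (empirical_measure n (\<lambda>i. Z i \<omega>)) \<pi>) \<longlonglongrightarrow> 0"
proof -
  interpret prob_space M by fact
  have Z[measurable]: "Z i \<in> borel_measurable M" for i
    using indep unfolding indep_vars_def by auto
  have \<pi>: "prob_space \<pi>" "sets \<pi> = sets borel"
    unfolding distr[of 0, symmetric] by (auto intro: prob_space_distr)
  have "\<exists>A B. (\<forall>j. A j \<in> sets borel \<and> B j \<in> sets borel) \<and>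
      (\<forall>U. upset U \<longrightarrow> (\<exists>j\<le>Suc k. B j \<subseteq> U \<and> U \<subseteq> A j \<and> measure \<pi> (A j) - measure \<pi> (B j) \<le> 1 / real (Suc k)))"
    for k :: nat
    by (rule upset_brackets[OF \<pi>, of "Suc k"]) auto
  then obtain A B :: "nat \<Rightarrow> nat \<Rightarrow> real set" where
    [measurable]: "\<And>k j. A k j \<in> sets borel" "\<And>k j. B k j \<in> sets borel" and
    br: "\<And>k U. upset U \<Longrightarrow> \<exists>j\<le>Suc k. B k j \<subseteq> U \<and> U \<subseteq> A k j \<and>
      measure \<pi> (A k j) - measure \<pi> (B k j) \<le> 1 / real (Suc k)"
    by metis
  note conv = empirical_measure_tendsto_AE[OF M indep distr]
  have "AE \<omega> in M. \<forall>k j. (\<lambda>n. measure (empirical_measure n (\<lambda>i. Z i \<omega>)) (A k j)) \<longlonglongrightarrow> measure \<pi> (A k j)"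
    "AE \<omega> in M. \<forall>k j. (\<lambda>n. measure (empirical_measure n (\<lambda>i. Z i \<omega>)) (B k j)) \<longlonglongrightarrow> measure \<pi> (B k j)"
    by (simp_all add: AE_all_countable conv)
  then show ?thesis
  proof eventually_elim
    case (elim \<omega>)
    let ?\<mu> = "\<lambda>n. empirical_measure n (\<lambda>i. Z i \<omega>)"
    show ?case
    proof (rule tendstoI)
      fix e :: real assume "e > 0"
      then obtain k where k: "1 / real (Suc k) < e / 2" using nat_approx_posE[of "e / 2"] by auto
      have ev: "eventually (\<lambda>n. \<forall>j\<in>{..Suc k}. \<bar>measure (?\<mu> n) (A k j) - measure \<pi> (A k j)\<bar> < e / 4 \<and>
          \<bar>measure (?\<mu> n) (B k j) - measure \<pi> (B k j)\<bar> < e / 4) sequentially"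
      proof (intro eventually_ball_finite ballI eventually_conj)
        fix j
        show "eventually (\<lambda>n. \<bar>measure (?\<mu> n) (A k j) - measure \<pi> (A k j)\<bar> < e / 4) sequentially"
          "eventually (\<lambda>n. \<bar>measure (?\<mu> n) (B k j) - measure \<pi> (B k j)\<bar> < e / 4) sequentially"
          using tendstoD[OF elim(1)[rule_format, of k j], of "e / 4"]
            tendstoD[OF elim(2)[rule_format, of k j], of "e / 4"] \<open>e > 0\<close>
          by (simp_all add: dist_real_def)
      qed simp
      show "eventually (\<lambda>n. dist (ks_distance (?\<mu> n) \<pi>) 0 < e) sequentially"
        using ev eventually_ge_at_top[of "1::nat"]
      proof eventually_elim
        case (elim n)
        note \<mu> = prob_space_empirical_measure[OF elim(2)]
        interpret \<mu>: prob_space "?\<mu> n" by (rule \<mu>)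
        interpret \<pi>: prob_space \<pi> by fact
        have "ks_distance (?\<mu> n) \<pi> \<le> 1 / real (Suc k) + e / 4"
        proof (rule ks_distance_least)
          fix U assume U: "upset U"
          from br[OF U, of k] obtain j where j: "j \<le> Suc k" "B k j \<subseteq> U" "U \<subseteq> A k j"
            "measure \<pi> (A k j) - measure \<pi> (B k j) \<le> 1 / real (Suc k)" by auto
          have "measure (?\<mu> n) (B k j) \<le> measure (?\<mu> n) U" "measure (?\<mu> n) U \<le> measure (?\<mu> n) (A k j)"
            "measure \<pi> (B k j) \<le> measure \<pi> U" "measure \<pi> U \<le> measure \<pi> (A k j)"
            using j upset_borel[OF U] \<pi> by (auto intro!: \<mu>.finite_measure_mono \<pi>.finite_measure_mono)
          moreover have "\<bar>measure (?\<mu> n) (A k j) - measure \<pi> (A k j)\<bar> < e / 4"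
            "\<bar>measure (?\<mu> n) (B k j) - measure \<pi> (B k j)\<bar> < e / 4"
            using elim(1) j(1) by auto
          ultimately show "\<bar>measure (?\<mu> n) U - measure \<pi> U\<bar> \<le> 1 / real (Suc k) + e / 4"
            using j(4) by linarith
        qed
        then show ?case using k ks_distance_nonneg[OF \<mu> \<pi>(1)] \<open>e > 0\<close> by (simp add: dist_real_def)
      qed
    qed
  qed
qed

section \<open>Laplace transforms of products of gamma distributions\<close>

lemma sets_gamma_distr [simp, measurable_cong]: "sets (gamma_distr a) = sets borel"
  by (simp add: gamma_distr_def)

text \<open>
  For positive shape, substituting \<open>x / (1 - l)\<close> for \<open>x\<close> turns \<open>exp (l * x)\<close> times the gamma density
  into a multiple of the gamma density. The nonnegative integral gives at once the total mass
  (\<open>l = 0\<close>), the integrability of the exponential and its expectation.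
\<close>

lemma nn_integral_exp_gamma_distr:
  assumes a: "0 \<le> a" and l: "l < 1"
  shows "(\<integral>\<^sup>+x. ennreal (exp (l * x)) \<partial>gamma_distr a) = ennreal ((1 - l) powr (- a))"
proof (cases "a = 0")
  case True
  then show ?thesis using l by (simp add: gamma_distr_def nn_integral_return)
next
  case False
  with a have a: "a > 0" by simp
  define f where "f x = (if 0 < x then x powr (a - 1) * exp (- x) / Gamma a else 0)" for x :: real
  have G: "Gamma a > 0" using a by (simp add: Gamma_real_pos)
  have [measurable]: "f \<in> borel_measurable borel" unfolding f_def by measurable
  have f0: "f x \<ge> 0" for x using G by (simp add: f_def)
  have int1: "(\<integral>\<^sup>+x. ennreal (f x) \<partial>lborel) = 1"
  proof -
    have "ennreal (f x) = ennreal (1 / Gamma a) * ennreal (indicator {0..} x * x powr (a - 1) / exp x)" for x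
      using G by (auto simp: f_def ennreal_mult'[symmetric] indicator_def exp_minus field_simps)
    then have "(\<integral>\<^sup>+x. ennreal (f x) \<partial>lborel) = ennreal (1 / Gamma a) * ennreal (Gamma a)"
      by (simp add: nn_integral_cmult Gamma_conv_nn_integral_real[OF a])
    also have "\<dots> = 1" using G by (simp add: ennreal_mult'[symmetric])
    finally show ?thesis .
  qed
  have "(\<integral>\<^sup>+x. ennreal (exp (l * x)) \<partial>gamma_distr a) = (\<integral>\<^sup>+x. ennreal (f x * exp (l * x)) \<partial>lborel)"
    using a f0 unfolding gamma_distr_def
    by (simp add: nn_integral_density f_def[symmetric] ennreal_mult')
  also have "\<dots> = ennreal \<bar>1 / (1 - l)\<bar> *
      (\<integral>\<^sup>+x. ennreal (f (0 + 1 / (1 - l) * x) * exp (l * (0 + 1 / (1 - l) * x))) \<partial>lborel)"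
    by (rule nn_integral_real_affine) (use l in auto)
  also have "(\<lambda>x. f (0 + 1 / (1 - l) * x) * exp (l * (0 + 1 / (1 - l) * x))) =
      (\<lambda>x. (1 - l) powr (1 - a) * f x)"
  proof
    fix x
    show "f (0 + 1 / (1 - l) * x) * exp (l * (0 + 1 / (1 - l) * x)) = (1 - l) powr (1 - a) * f x"
    proof (cases "x > 0")
      case True
      have "(x / (1 - l)) powr (a - 1) = x powr (a - 1) * (1 - l) powr (1 - a)"
        using True l by (simp add: powr_divide powr_diff)
      moreover have "exp (- (x / (1 - l))) * exp (l * x / (1 - l)) = exp (- x)"
      proof -
        have "- (x / (1 - l)) + l * x / (1 - l) = (- x * (1 - l)) / (1 - l)"
          by (simp add: add_divide_distrib[symmetric] diff_divide_distrib[symmetric] algebra_simps)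
        also have "\<dots> = - x" using l by simp
        finally show ?thesis unfolding exp_add[symmetric] by simp
      qed
      ultimately show ?thesis using True l by (simp add: f_def field_simps)
    next
      case False
      then have "\<not> 0 < x / (1 - l)" using l by (simp add: zero_less_divide_iff)
      with False show ?thesis by (simp add: f_def)
    qed
  qed
  also have "(\<integral>\<^sup>+x. ennreal ((1 - l) powr (1 - a) * f x) \<partial>lborel) = ennreal ((1 - l) powr (1 - a))"
    by (simp add: ennreal_mult' f0 nn_integral_cmult int1)
  also have "ennreal \<bar>1 / (1 - l)\<bar> * ennreal ((1 - l) powr (1 - a)) = ennreal ((1 - l) powr (- a))"
    using l by (simp add: ennreal_mult'[symmetric] powr_diff powr_minus field_simps)
  finally show ?thesis .
qed

lemma prob_space_gamma_distr: "0 \<le> a \<Longrightarrow> prob_space (gamma_distr a)"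
  using nn_integral_exp_gamma_distr[of a 0] by (intro prob_spaceI) simp

lemma AE_gamma_distr_nonneg: "AE x in gamma_distr a. 0 \<le> x"
proof (cases "a = 0")
  case False
  then have *: "gamma_distr a = density lborel
      (\<lambda>x. ennreal (if 0 < x then x powr (a - 1) * exp (- x) / Gamma a else 0))"
    by (simp add: gamma_distr_def)
  show ?thesis unfolding * by (subst AE_density) auto
next
  case True
  then have *: "gamma_distr a = return borel 0" by (simp add: gamma_distr_def)
  show ?thesis unfolding * by (subst AE_return) auto
qed

lemma exp_gamma_distr:
  assumes a: "0 \<le> a" and l: "l < 1"
  shows "integrable (gamma_distr a) (\<lambda>x. exp (l * x))"
    and "(\<integral>x. exp (l * x) \<partial>gamma_distr a) = exp (- a * ln (1 - l))"
proof -
  show "integrable (gamma_distr a) (\<lambda>x. exp (l * x))"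
    using nn_integral_exp_gamma_distr[OF assms] by (intro integrableI_bounded) auto
  show "(\<integral>x. exp (l * x) \<partial>gamma_distr a) = exp (- a * ln (1 - l))"
    using nn_integral_exp_gamma_distr[OF assms] l
    by (subst integral_eq_nn_integral) (auto simp: powr_def)
qed

lemma exp_linear_gamma_product:
  fixes \<alpha> \<theta> :: "nat \<Rightarrow> real"
  assumes \<alpha>: "\<And>i. 0 \<le> \<alpha> i" and \<theta>: "\<And>i. i < k \<Longrightarrow> \<theta> i < 1"
  shows "integrable (\<Pi>\<^sub>M i\<in>{..<k}. gamma_distr (\<alpha> i)) (\<lambda>y. exp (\<Sum>i<k. \<theta> i * y i))"
    and "(\<integral>y. exp (\<Sum>i<k. \<theta> i * y i) \<partial>(\<Pi>\<^sub>M i\<in>{..<k}. gamma_distr (\<alpha> i))) =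
      exp (\<Sum>i<k. - \<alpha> i * ln (1 - \<theta> i))"
proof -
  interpret product_prob_space "\<lambda>i. gamma_distr (\<alpha> i)" "{..<k}"
    using \<alpha> prob_space_gamma_distr
    by (simp add: product_prob_space_def product_prob_space_axioms_def product_sigma_finite_def prob_space_imp_sigma_finite)
  have e: "exp (\<Sum>i<k. \<theta> i * y i) = (\<Prod>i<k. exp (\<theta> i * y i))" for y :: "nat \<Rightarrow> real"
    by (simp add: exp_sum)
  show "integrable (\<Pi>\<^sub>M i\<in>{..<k}. gamma_distr (\<alpha> i)) (\<lambda>y. exp (\<Sum>i<k. \<theta> i * y i))"
    unfolding e using \<alpha> \<theta> by (intro product_integrable_prod exp_gamma_distr) auto
  show "(\<integral>y. exp (\<Sum>i<k. \<theta> i * y i) \<partial>(\<Pi>\<^sub>M i\<in>{..<k}. gamma_distr (\<alpha> i))) =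
      exp (\<Sum>i<k. - \<alpha> i * ln (1 - \<theta> i))"
    unfolding e using \<alpha> \<theta> by (subst product_integral_prod) (auto simp: exp_gamma_distr exp_sum)
qed

section \<open>The Laplace transform of a Dirichlet distribution\<close>

lemma exp_diff_le: "\<bar>exp x - exp y\<bar> \<le> \<bar>x - y\<bar> * exp (max x y)" for x y :: real
proof (induction x y rule: linorder_wlog)
  case (le x y)
  have "exp y * (1 - exp (x - y)) \<le> exp y * (y - x)"
    using exp_ge_add_one_self[of "x - y"] by (intro mult_left_mono) (linarith, simp)
  moreover have "exp y * (1 - exp (x - y)) = exp y - exp x"
    by (simp add: right_diff_distrib exp_add[symmetric])
  ultimately have "exp y - exp x \<le> (y - x) * exp y" by (simp add: mult.commute)
  with le show ?case by (simp add: max_def)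
qed (simp add: abs_minus_commute max.commute)

text \<open>
  This pointwise estimate replaces the random normalisation \<open>W\<close> by the constant \<open>N\<close>. The
  application has \<open>W = (\<Sum>j. Y j)\<close>, a gamma variable with mean \<open>N\<close>, while \<open>b\<close> and \<open>a\<close> are the same
  linear form in the \<open>Y j\<close> divided by \<open>W\<close> and by \<open>N\<close>. If \<open>W\<close> is within \<open>\<delta> * N\<close> of \<open>N\<close>, then \<open>b\<close> and
  \<open>a\<close> differ by at most \<open>2 * \<delta> * \<bar>a\<bar>\<close>. Otherwise the sum of the two last exponentials is at least
  \<open>1\<close>: they are the Chernoff bounds for the two deviations of \<open>W\<close>, kept inside the pointwise estimate.
  Every term on the right is a constant times the exponential of an affine function of the \<open>Y j\<close>, so
  its expectation is explicit.
\<close>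

lemma exp_self_normalised_le:
  fixes a b W N B \<delta> :: real
  assumes \<delta>: "0 < \<delta>" "\<delta> \<le> 1 / 2" and N: "0 < N" and ab: "a * N = b * W" and b: "\<bar>b\<bar> \<le> B"
  shows "\<bar>exp b - exp a\<bar> \<le> 3 * \<delta> * (exp (3 * a) + exp (- 3 * a)) +
    (exp B + 1 / \<delta>) * (exp (\<delta> / 4 * (W - (1 + \<delta>) * N)) + exp (- \<delta> / 4 * (W - (1 - \<delta>) * N)))"
    (is "_ \<le> ?A + ?C * ?D")
proof (cases "\<bar>W - N\<bar> \<le> \<delta> * N")
  case True
  have W: "W \<ge> N / 2"
    using True mult_right_mono[OF \<delta>(2), of N] N by linarith
  have "(b - a) * W = a * (N - W)" using ab by (simp add: algebra_simps)
  then have "\<bar>b - a\<bar> * W = \<bar>a\<bar> * \<bar>N - W\<bar>" using W N by (metis abs_mult abs_of_nonneg le_divide_eq_numeral1(1) less_eq_real_def mult_zero_left order_trans)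
  also have "\<dots> \<le> \<bar>a\<bar> * (\<delta> * N)" using True by (intro mult_left_mono) auto
  also have "\<dots> \<le> \<bar>a\<bar> * (\<delta> * (2 * W))" using W \<delta> by (intro mult_left_mono) auto
  finally have "\<bar>b - a\<bar> * W \<le> (2 * \<delta> * \<bar>a\<bar>) * W" by (simp add: mult_ac)
  then have ba: "\<bar>b - a\<bar> \<le> 2 * \<delta> * \<bar>a\<bar>" using W N by (simp add: mult_le_cancel_right)
  also have "\<dots> \<le> 1 * \<bar>a\<bar>" using \<delta> by (intro mult_right_mono) auto
  finally have "max b a \<le> 2 * \<bar>a\<bar>" by linarith
  then have "\<bar>exp b - exp a\<bar> \<le> (2 * \<delta> * \<bar>a\<bar>) * exp (2 * \<bar>a\<bar>)"
    using \<delta> by (intro order_trans[OF exp_diff_le] mult_mono ba) auto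
  also have "\<dots> \<le> (2 * \<delta> * exp \<bar>a\<bar>) * exp (2 * \<bar>a\<bar>)"
    using exp_ge_add_one_self[of "\<bar>a\<bar>"] \<delta> by (intro mult_right_mono mult_left_mono) (linarith | simp)+
  also have "\<dots> = 2 * \<delta> * exp (3 * \<bar>a\<bar>)" by (simp add: exp_add[symmetric])
  also have "\<dots> \<le> 3 * \<delta> * (exp (3 * a) + exp (- 3 * a))"
    using \<delta> by (intro mult_mono) (auto simp: abs_if)
  finally have "\<bar>exp b - exp a\<bar> \<le> ?A" .
  moreover have "0 \<le> ?C * ?D" using \<delta> by (intro mult_nonneg_nonneg add_nonneg_nonneg) auto
  ultimately show ?thesis by linarith
next
  case False
  then have "W - (1 + \<delta>) * N \<ge> 0 \<or> W - (1 - \<delta>) * N \<le> 0"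
    by (auto simp: abs_if algebra_simps split: if_splits)
  then have "?D \<ge> 1"
  proof
    assume "W - (1 + \<delta>) * N \<ge> 0"
    then have "exp (\<delta> / 4 * (W - (1 + \<delta>) * N)) \<ge> 1" using \<delta> by simp
    then show ?thesis by (smt (verit) exp_gt_zero)
  next
    assume "W - (1 - \<delta>) * N \<le> 0"
    then have "exp (- \<delta> / 4 * (W - (1 - \<delta>) * N)) \<ge> 1" using \<delta> by (simp add: mult_nonneg_nonpos)
    then show ?thesis by (smt (verit) exp_gt_zero)
  qed
  then have CD: "?C * 1 \<le> ?C * ?D" using \<delta> by (intro mult_left_mono) auto
  \<comment> \<open>A weighted form of \<open>2 * x \<le> x\<^sup>2 + 1\<close>, used in place of the Cauchy--Schwarz inequality: on the
    exceptional event \<open>exp a\<close> is split into a small multiple of \<open>exp (2 * a)\<close> and a large constant.\<close>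
  have "exp a * 2 \<le> \<delta> * exp (2 * a) + 1 / \<delta>"
  proof -
    have "0 \<le> (\<delta> * exp a - 1)\<^sup>2 / \<delta>" using \<delta> by simp
    also have "\<dots> = \<delta> * exp (2 * a) + 1 / \<delta> - exp a * 2"
      using \<delta> unfolding exp_double by (simp add: power2_eq_square field_simps)
    finally show ?thesis by simp
  qed
  moreover have "\<delta> * exp (2 * a) \<le> 3 * \<delta> * (exp (3 * a) + exp (- 3 * a))"
  proof -
    have "exp (2 * a) \<le> exp (3 * a) + exp (- 3 * a)"
    proof (cases "a \<ge> 0")
      case True
      then have "exp (2 * a) \<le> exp (3 * a)" by simp
      then show ?thesis by (smt (verit) exp_gt_zero)
    next
      case False
      then have "exp (2 * a) \<le> exp (- 3 * a)" by simp
      then show ?thesis by (smt (verit) exp_gt_zero)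
    qed
    then have "\<delta> * exp (2 * a) \<le> \<delta> * (exp (3 * a) + exp (- 3 * a))" using \<delta> by (intro mult_left_mono) auto
    moreover have "0 < \<delta> * (exp (3 * a) + exp (- 3 * a))"
      using \<delta> by (intro mult_pos_pos add_pos_pos) auto
    ultimately show ?thesis by linarith
  qed
  moreover have "exp b \<le> exp B" using b by simp
  moreover have "0 < exp a" "0 < exp b" by auto
  moreover have "exp (2 * a) > 0" "1 / \<delta> > 0" using \<delta> by auto
  ultimately have "\<bar>exp b - exp a\<bar> \<le> ?A + ?C" by linarith
  then show ?thesis by (rule order_trans[OF _ add_left_mono]) (use CD in simp)
qed

text \<open>
  Mean value theorem: the derivative of the remainder is \<open>u\<^sup>2 / (1 - u)\<close>, which is at most \<open>2 * x\<^sup>2\<close>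
  between \<open>- \<bar>x\<bar>\<close> and \<open>\<bar>x\<bar>\<close>.
\<close>

lemma ln_second_order:
  fixes x :: real
  assumes "\<bar>x\<bar> \<le> 1 / 2"
  shows "\<bar>- ln (1 - x) - (x + x\<^sup>2 / 2)\<bar> \<le> 2 * \<bar>x\<bar> ^ 3"
proof -
  define f where "f u = - ln (1 - u) - (u + u\<^sup>2 / 2)" for u :: real
  define f' where "f' u = u\<^sup>2 / (1 - u)" for u :: real
  have "norm (f x - f 0) \<le> (2 * x\<^sup>2) * norm (x - 0)"
  proof (rule field_differentiable_bound[where S = "{-\<bar>x\<bar>..\<bar>x\<bar>}" and f' = f'])
    fix u assume u: "u \<in> {-\<bar>x\<bar>..\<bar>x\<bar>}"
    then have u1: "1 - u \<ge> 1 / 2" using assms by auto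
    show "(f has_field_derivative f' u) (at u within {-\<bar>x\<bar>..\<bar>x\<bar>})"
      unfolding f_def f'_def using u1
      by (auto intro!: derivative_eq_intros simp: field_simps power2_eq_square)
    have "u\<^sup>2 \<le> x\<^sup>2" using u by (subst abs_le_square_iff[symmetric]) (auto simp: abs_le_iff)
    moreover have "u\<^sup>2 / (1 - u) \<le> u\<^sup>2 / (1 / 2)" using u1 by (intro divide_left_mono) auto
    ultimately show "norm (f' u) \<le> 2 * x\<^sup>2" using u1 by (simp add: f'_def)
  qed auto
  then show ?thesis by (simp add: f_def power3_eq_cube power2_eq_square abs_mult)
qed

lemma ln_first_order:
  fixes x :: real
  assumes "\<bar>x\<bar> \<le> 1 / 2"
  shows "- ln (1 - x) \<le> x + 2 * x\<^sup>2"
  using abs_ln_one_plus_x_minus_x_bound[of "- x"] assms by (simp add: abs_le_iff)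

lemma exp_linear_gamma_product_le:
  fixes \<alpha> \<theta> :: "nat \<Rightarrow> real"
  assumes \<alpha>: "\<And>i. 0 \<le> \<alpha> i" and \<theta>: "\<And>i. i < k \<Longrightarrow> \<bar>\<theta> i\<bar> \<le> 1 / 2"
  shows "(\<integral>y. exp (\<Sum>i<k. \<theta> i * y i) \<partial>(\<Pi>\<^sub>M i\<in>{..<k}. gamma_distr (\<alpha> i))) \<le>
      exp (\<Sum>i<k. \<alpha> i * (\<theta> i + 2 * (\<theta> i)\<^sup>2))"
proof -
  have "\<theta> i < 1" if "i < k" for i using \<theta>[OF that] by linarith
  moreover have "- \<alpha> i * ln (1 - \<theta> i) \<le> \<alpha> i * (\<theta> i + 2 * (\<theta> i)\<^sup>2)" if "i < k" for i
    using mult_left_mono[OF ln_first_order[OF \<theta>[OF that]] \<alpha>[of i]] by simp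
  ultimately show ?thesis
    using \<alpha> by (subst exp_linear_gamma_product) (auto intro: sum_mono)
qed

text \<open>
  Here \<open>N\<close> is the total mass of the Dirichlet parameters, \<open>K\<close> a bound for the function integrated,
  \<open>m\<close> its integral against the parameters, \<open>s\<close> the argument of the Laplace transform and \<open>\<delta>\<close> the
  relative deviation of the normalising gamma variable that is tolerated. With \<open>s\<close> of order \<open>sqrt N\<close>
  and bounded \<open>K\<close> and \<open>m\<close>, the first exponential is bounded, and for \<open>\<delta>\<close> that tends to \<open>0\<close> more slowly
  than the power \<open>- 1 / 4\<close> of \<open>N\<close> the factor \<open>exp (- N * \<delta>\<^sup>2 / 8)\<close> beats \<open>exp (\<bar>s\<bar> * K)\<close>.
\<close>

definition laplace_error :: "real \<Rightarrow> real \<Rightarrow> real \<Rightarrow> real \<Rightarrow> real \<Rightarrow> real" where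
  "laplace_error \<delta> s N K m =
    (6 * \<delta> + 2 * N * (\<bar>s / N\<bar> * K) ^ 3) * exp (3 * \<bar>s / N * m\<bar> + 18 * N * (s / N * K)\<^sup>2) +
    2 * (exp (\<bar>s\<bar> * K) + 1 / \<delta>) * exp (- N * \<delta>\<^sup>2 / 8)"

text \<open>
  Write the Dirichlet vector as \<open>y / W y\<close> with independent gamma variables \<open>y i\<close>. Replacing \<open>W\<close> by its
  mean \<open>N\<close> costs what the previous pointwise estimate says. After that the expectation is
  \<open>exp (- \<Sum>i. \<alpha> i * ln (1 - s / N * c i))\<close>, and the logarithm is expanded to second order.
\<close>

lemma dirichlet_laplace:
  fixes \<alpha> c :: "nat \<Rightarrow> real" and k :: nat and K s \<delta> :: real
  assumes \<alpha>: "\<And>i. 0 \<le> \<alpha> i" and c: "\<And>i. i < k \<Longrightarrow> \<bar>c i\<bar> \<le> K"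
    and \<delta>: "0 < \<delta>" "\<delta> \<le> 1 / 2"
  defines "N \<equiv> \<Sum>i<k. \<alpha> i"
  defines "m1 \<equiv> \<Sum>i<k. \<alpha> i * c i"
  defines "m2 \<equiv> \<Sum>i<k. \<alpha> i * (c i)\<^sup>2"
  assumes N: "0 < N" and small: "3 * (\<bar>s / N\<bar> * K) \<le> 1 / 2"
  shows "\<bar>(\<integral>x. exp (s * (\<Sum>i<k. c i * x i)) \<partial>dirichlet_distr k \<alpha>) -
      exp (s / N * m1 + (s / N)\<^sup>2 * m2 / 2)\<bar> \<le> laplace_error \<delta> s N K m1"
proof -
  define l where "l = s / N"
  have s: "s = l * N" using N by (simp add: l_def)
  have k: "k > 0" using N by (auto simp: N_def intro: ccontr)
  have K: "0 \<le> K" using c[OF k] by linarith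
  define P where "P = (\<Pi>\<^sub>M i\<in>{..<k}. gamma_distr (\<alpha> i))"
  interpret product_prob_space "\<lambda>i. gamma_distr (\<alpha> i)" "{..<k}"
    using \<alpha> prob_space_gamma_distr
    by (simp add: product_prob_space_def product_prob_space_axioms_def product_sigma_finite_def prob_space_imp_sigma_finite)
  interpret PS: prob_space P unfolding P_def by (rule prob_space_PiM) (rule M.prob_space_axioms)
  define W where "W y = (\<Sum>i<k. y i)" for y :: "nat \<Rightarrow> real"
  define a where "a y = l * (\<Sum>i<k. c i * y i)" for y :: "nat \<Rightarrow> real"
  define b where "b y = s * (\<Sum>i<k. c i * (y i / W y))" for y :: "nat \<Rightarrow> real"
  have [measurable]: "W \<in> borel_measurable P" "a \<in> borel_measurable P" "b \<in> borel_measurable P"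
    unfolding W_def a_def b_def P_def by measurable
  have pos: "AE y in P. \<forall>i\<in>{..<k}. 0 \<le> y i"
    unfolding P_def
    by (intro AE_finite_allI AE_PiM_component M.prob_space_axioms AE_gamma_distr_nonneg) auto
  have lc: "\<bar>l * c i\<bar> \<le> \<bar>l\<bar> * K" if "i < k" for i
    using c[OF that] by (simp add: abs_mult mult_left_mono)
  have dir: "(\<integral>x. exp (s * (\<Sum>i<k. c i * x i)) \<partial>dirichlet_distr k \<alpha>) = (\<integral>y. exp (b y) \<partial>P)"
    unfolding dirichlet_distr_def P_def b_def W_def
    by (subst integral_distr) (auto intro!: Bochner_Integration.integral_cong sum.cong arg_cong[of _ _ exp] arg_cong2[of _ _ _ _ "(*)"])
  have a_eq: "t * a y = (\<Sum>i<k. (t * l * c i) * y i)" for t y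
    by (simp add: a_def sum_distrib_left mult_ac)
  have W_eq: "t * W y = (\<Sum>i<k. t * y i)" for t y
    by (simp add: W_def sum_distrib_left)
  have a3: "integrable P (\<lambda>y. exp (t * a y))"
      "(\<integral>y. exp (t * a y) \<partial>P) \<le> exp (3 * \<bar>l * m1\<bar> + 18 * N * (l * K)\<^sup>2)" if t: "\<bar>t\<bar> \<le> 3" for t
  proof -
    have th2: "\<bar>t * l * c i\<bar> \<le> 3 * (\<bar>l\<bar> * K)" if "i < k" for i
      using mult_mono[OF t lc[OF that]] by (simp add: abs_mult mult_ac)
    then have th1: "\<bar>t * l * c i\<bar> \<le> 1 / 2" if "i < k" for i
      using that small unfolding l_def[symmetric] by (meson order_trans)
    show "integrable P (\<lambda>y. exp (t * a y))"
      unfolding a_eq P_def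
    proof (rule exp_linear_gamma_product[OF \<alpha>])
      show "t * l * c i < 1" if "i < k" for i using th1[OF that] by linarith
    qed
    have "(\<integral>y. exp (t * a y) \<partial>P) \<le> exp (\<Sum>i<k. \<alpha> i * (t * l * c i + 2 * (t * l * c i)\<^sup>2))"
      unfolding a_eq P_def by (rule exp_linear_gamma_product_le[OF \<alpha> th1])
    also have "\<dots> \<le> exp (3 * \<bar>l * m1\<bar> + 18 * N * (l * K)\<^sup>2)"
    proof -
      have "(t * l * c i)\<^sup>2 \<le> 9 * (l * K)\<^sup>2" if "i < k" for i
      proof -
        have "\<bar>t * l * c i\<bar>\<^sup>2 \<le> (3 * (\<bar>l\<bar> * K))\<^sup>2"
          by (rule power_mono[OF th2[OF that]]) simp
        then show ?thesis by (simp add: power_mult_distrib)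
      qed
      then have "(\<Sum>i<k. \<alpha> i * (t * l * c i + 2 * (t * l * c i)\<^sup>2)) \<le>
          (\<Sum>i<k. t * l * (\<alpha> i * c i) + 18 * (l * K)\<^sup>2 * \<alpha> i)"
        using \<alpha> by (intro sum_mono) (smt (verit, best) distrib_left lessThan_iff mult.assoc mult.commute mult_left_mono)
      also have "\<dots> = t * (l * m1) + 18 * N * (l * K)\<^sup>2"
        by (simp add: sum.distrib sum_distrib_left[symmetric] m1_def N_def)
      also have "t * (l * m1) \<le> \<bar>t\<bar> * \<bar>l * m1\<bar>" unfolding abs_mult[symmetric] by (rule abs_ge_self)
      also have "\<dots> \<le> 3 * \<bar>l * m1\<bar>" using t by (intro mult_right_mono) auto
      finally show ?thesis by simp
    qed
    finally show "(\<integral>y. exp (t * a y) \<partial>P) \<le> exp (3 * \<bar>l * m1\<bar> + 18 * N * (l * K)\<^sup>2)" .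
  qed
  have W3: "integrable P (\<lambda>y. exp (t * (W y - r)))"
      "(\<integral>y. exp (t * (W y - r)) \<partial>P) \<le> exp (t * (N - r) + 2 * t\<^sup>2 * N)" if t: "\<bar>t\<bar> \<le> 1 / 2" for t r
  proof -
    have e: "exp (t * (W y - r)) = exp (- t * r) * exp (\<Sum>i<k. t * y i)" for y
      unfolding W_eq[symmetric] exp_add[symmetric] by (simp add: algebra_simps)
    have t1: "t < 1" using t by linarith
    show "integrable P (\<lambda>y. exp (t * (W y - r)))"
      unfolding e P_def by (intro integrable_mult_right exp_linear_gamma_product \<alpha> t1)
    have "(\<integral>y. exp (t * (W y - r)) \<partial>P) \<le> exp (- t * r) * exp (\<Sum>i<k. \<alpha> i * (t + 2 * t\<^sup>2))"
      unfolding e P_def using exp_linear_gamma_product_le[OF \<alpha>, of k "\<lambda>_. t"] t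
      by simp
    also have "\<dots> = exp (t * (N - r) + 2 * t\<^sup>2 * N)"
      unfolding exp_add[symmetric] sum_distrib_right[symmetric] N_def[symmetric]
      by (simp add: algebra_simps)
    finally show "(\<integral>y. exp (t * (W y - r)) \<partial>P) \<le> exp (t * (N - r) + 2 * t\<^sup>2 * N)" .
  qed
  \<comment> \<open>The identity also holds where \<open>W y = 0\<close>: there all \<open>y i\<close> are \<open>0\<close>, and both sides vanish.\<close>
  have b_bound: "AE y in P. \<bar>b y\<bar> \<le> \<bar>s\<bar> * K \<and> a y * N = b y * W y"
    using pos
  proof eventually_elim
    case (elim y)
    have W0: "W y \<ge> 0" unfolding W_def using elim by (auto intro: sum_nonneg)
    have y0: "y i = 0" if "W y = 0" "i < k" for i
      using that elim unfolding W_def by (subst (asm) sum_nonneg_eq_0_iff) auto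
    have "\<bar>\<Sum>i<k. c i * (y i / W y)\<bar> \<le> (\<Sum>i<k. K * (y i / W y))"
      by (intro order_trans[OF sum_abs] sum_mono)
        (use elim W0 c in \<open>auto simp: abs_mult abs_divide intro!: mult_right_mono divide_right_mono\<close>)
    also have "\<dots> = K * (W y / W y)"
      by (simp add: sum_distrib_left[symmetric] sum_divide_distrib[symmetric] W_def)
    also have "\<dots> \<le> K" using K by (cases "W y = 0") auto
    finally have "\<bar>b y\<bar> \<le> \<bar>s\<bar> * K" unfolding b_def abs_mult by (intro mult_left_mono) auto
    moreover have "a y * N = b y * W y"
    proof (cases "W y = 0")
      case True
      with y0 show ?thesis by (simp add: a_def)
    next
      case False
      have "(\<Sum>i<k. c i * (y i / W y)) = (\<Sum>i<k. c i * y i) / W y"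
        by (simp add: sum_divide_distrib)
      then show ?thesis using False by (simp add: a_def b_def s)
    qed
    ultimately show ?case by simp
  qed
  define C where "C = exp (\<bar>s\<bar> * K) + 1 / \<delta>"
  have C: "0 \<le> C" using \<delta> by (simp add: C_def add_nonneg_nonneg)
  define R where "R y = 3 * \<delta> * (exp (3 * a y) + exp (- 3 * a y)) +
      C * (exp (\<delta> / 4 * (W y - (1 + \<delta>) * N)) + exp (- \<delta> / 4 * (W y - (1 - \<delta>) * N)))" for y
  have \<delta>4: "\<bar>\<delta> / 4\<bar> \<le> 1 / 2" "\<bar>- \<delta> / 4\<bar> \<le> 1 / 2" using \<delta> by auto
  have intR: "integrable P R"
    unfolding R_def by (intro Bochner_Integration.integrable_add integrable_mult_right a3 W3) (use \<delta> in auto)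
  \<comment> \<open>The slope \<open>\<delta> / 4\<close> maximises \<open>t * \<delta> - 2 * t\<^sup>2\<close>, with value \<open>\<delta>\<^sup>2 / 8\<close>.\<close>
  have bad: "(\<integral>y. exp (\<delta> / 4 * (W y - (1 + \<delta>) * N)) \<partial>P) \<le> exp (- N * \<delta>\<^sup>2 / 8)"
    "(\<integral>y. exp (- \<delta> / 4 * (W y - (1 - \<delta>) * N)) \<partial>P) \<le> exp (- N * \<delta>\<^sup>2 / 8)"
    using W3(2)[OF \<delta>4(1), of "(1 + \<delta>) * N"] W3(2)[OF \<delta>4(2), of "(1 - \<delta>) * N"]
    by (simp_all add: algebra_simps power2_eq_square)
  have "(\<integral>y. R y \<partial>P) = 3 * \<delta> * ((\<integral>y. exp (3 * a y) \<partial>P) + (\<integral>y. exp (- 3 * a y) \<partial>P)) +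
      C * ((\<integral>y. exp (\<delta> / 4 * (W y - (1 + \<delta>) * N)) \<partial>P) + (\<integral>y. exp (- \<delta> / 4 * (W y - (1 - \<delta>) * N)) \<partial>P))"
    unfolding R_def using a3(1)[of 3] a3(1)[of "-3"] W3(1)[OF \<delta>4(1)] W3(1)[OF \<delta>4(2)]
    by simp
  also have "\<dots> \<le> 3 * \<delta> * (exp (3 * \<bar>l * m1\<bar> + 18 * N * (l * K)\<^sup>2) + exp (3 * \<bar>l * m1\<bar> + 18 * N * (l * K)\<^sup>2)) +
      C * (exp (- N * \<delta>\<^sup>2 / 8) + exp (- N * \<delta>\<^sup>2 / 8))"
    using \<delta> C by (intro add_mono mult_left_mono a3(2) bad) auto
  finally have R_le: "(\<integral>y. R y \<partial>P) \<le> 6 * \<delta> * exp (3 * \<bar>l * m1\<bar> + 18 * N * (l * K)\<^sup>2) + 2 * C * exp (- N * \<delta>\<^sup>2 / 8)"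
    by (simp add: algebra_simps)
  have intb: "integrable P (\<lambda>y. exp (b y))"
    by (rule PS.integrable_const_bound[of _ "exp (\<bar>s\<bar> * K)"]) (use b_bound in \<open>auto elim!: eventually_mono\<close>)
  have inta: "integrable P (\<lambda>y. exp (a y))" using a3(1)[of 1] by simp
  have "\<bar>(\<integral>y. exp (b y) \<partial>P) - (\<integral>y. exp (a y) \<partial>P)\<bar> = \<bar>\<integral>y. exp (b y) - exp (a y) \<partial>P\<bar>"
    using intb inta by simp
  also have "\<dots> \<le> (\<integral>y. \<bar>exp (b y) - exp (a y)\<bar> \<partial>P)" by (rule integral_abs_bound)
  also have "\<dots> \<le> (\<integral>y. R y \<partial>P)"
  proof (rule integral_mono_AE)
    show "AE y in P. \<bar>exp (b y) - exp (a y)\<bar> \<le> R y"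
      using b_bound
    proof eventually_elim
      case (elim y)
      then show ?case unfolding R_def C_def by (intro exp_self_normalised_le[OF \<delta> N]) auto
    qed
  qed (use intb inta intR in auto)
  finally have step1: "\<bar>(\<integral>y. exp (b y) \<partial>P) - (\<integral>y. exp (a y) \<partial>P)\<bar> \<le>
      6 * \<delta> * exp (3 * \<bar>l * m1\<bar> + 18 * N * (l * K)\<^sup>2) + 2 * C * exp (- N * \<delta>\<^sup>2 / 8)"
    using R_le by linarith
  define u where "u = (\<Sum>i<k. - \<alpha> i * ln (1 - l * c i))"
  define v where "v = l * m1 + l\<^sup>2 * m2 / 2"
  have lK: "\<bar>l\<bar> * K \<le> 1 / 2" using small K unfolding l_def[symmetric] by (smt (verit) mult_nonneg_nonneg)
  have lc2: "\<bar>l * c i\<bar> \<le> 1 / 2" if "i < k" for i using lc[OF that] lK by linarith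
  have Ea: "(\<integral>y. exp (a y) \<partial>P) = exp u"
    using exp_linear_gamma_product(2)[OF \<alpha>, of k "\<lambda>i. l * c i"] lc2 a_eq[of 1]
    unfolding u_def P_def by force
  have "\<bar>u - v\<bar> \<le> 2 * N * (\<bar>l\<bar> * K) ^ 3"
  proof -
    have v: "v = (\<Sum>i<k. \<alpha> i * (l * c i + (l * c i)\<^sup>2 / 2))"
      by (simp add: v_def m1_def m2_def sum_distrib_left sum.distrib sum_divide_distrib algebra_simps power_mult_distrib)
    have "\<bar>u - v\<bar> \<le> (\<Sum>i<k. \<bar>\<alpha> i * (- ln (1 - l * c i) - (l * c i + (l * c i)\<^sup>2 / 2))\<bar>)"
      unfolding u_def v sum_subtractf[symmetric]
      by (intro order_trans[OF sum_abs] sum_mono) (simp add: algebra_simps)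
    also have "\<dots> \<le> (\<Sum>i<k. \<alpha> i * (2 * (\<bar>l\<bar> * K) ^ 3))"
    proof (rule sum_mono)
      fix i assume "i \<in> {..<k}"
      then have i: "i < k" by simp
      have "\<bar>- ln (1 - l * c i) - (l * c i + (l * c i)\<^sup>2 / 2)\<bar> \<le> 2 * \<bar>l * c i\<bar> ^ 3"
        by (rule ln_second_order[OF lc2[OF i]])
      also have "\<dots> \<le> 2 * (\<bar>l\<bar> * K) ^ 3"
        using power_mono[OF lc[OF i], of 3] by simp
      finally show "\<bar>\<alpha> i * (- ln (1 - l * c i) - (l * c i + (l * c i)\<^sup>2 / 2))\<bar> \<le> \<alpha> i * (2 * (\<bar>l\<bar> * K) ^ 3)"
        using \<alpha>[of i] by (simp add: abs_mult mult_left_mono)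
    qed
    also have "\<dots> = 2 * N * (\<bar>l\<bar> * K) ^ 3"
      by (simp add: N_def sum_distrib_right[symmetric] mult_ac)
    finally show ?thesis .
  qed
  moreover have "max u v \<le> 3 * \<bar>l * m1\<bar> + 18 * N * (l * K)\<^sup>2"
  proof -
    have "exp u \<le> exp (3 * \<bar>l * m1\<bar> + 18 * N * (l * K)\<^sup>2)"
      using a3(2)[of 1] Ea by simp
    moreover have "m2 \<le> N * K\<^sup>2"
      unfolding m2_def N_def sum_distrib_right
      by (intro sum_mono mult_left_mono \<alpha>) (use c K in \<open>auto simp: abs_le_square_iff[symmetric]\<close>)
    then have "l\<^sup>2 * m2 / 2 \<le> l\<^sup>2 * (N * K\<^sup>2) / 2" by (intro divide_right_mono mult_left_mono) auto
    then have "l\<^sup>2 * m2 / 2 \<le> N * (l * K)\<^sup>2 / 2" by (simp add: power_mult_distrib mult_ac)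
    moreover have "0 \<le> N * (l * K)\<^sup>2" using N by simp
    ultimately show ?thesis unfolding v_def by simp
  qed
  ultimately have step2: "\<bar>exp u - exp v\<bar> \<le> 2 * N * (\<bar>l\<bar> * K) ^ 3 * exp (3 * \<bar>l * m1\<bar> + 18 * N * (l * K)\<^sup>2)"
    by (intro order_trans[OF exp_diff_le] mult_mono) auto
  have "\<bar>(\<integral>y. exp (b y) \<partial>P) - exp v\<bar> \<le> \<bar>(\<integral>y. exp (b y) \<partial>P) - exp u\<bar> + \<bar>exp u - exp v\<bar>"
    by linarith
  also note add_mono[OF step1[unfolded Ea] step2]
  finally show ?thesis
    unfolding dir laplace_error_def l_def[symmetric] C_def v_def by (simp add: algebra_simps)
qed

section \<open>The Laplace transform of a Dirichlet process\<close>

text \<open>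
  A Dirichlet process is described by its values on finite partitions. A simple function is linear in
  these values, and its integrals against all measures use the same partition \<open>A\<close>. The free function
  \<open>\<phi>\<close> gives the total mass, the mean and the second moment from a single formula.
\<close>

lemma simple_function_partition:
  fixes u :: "real \<Rightarrow> real"
  assumes u: "simple_function borel u"
  obtains k :: nat and c :: "nat \<Rightarrow> real" and A :: "nat \<Rightarrow> real set" where
    "\<And>i. A i \<in> sets borel" "disjoint_family_on A {..<k}" "(\<Union>i<k. A i) = UNIV"
    "\<And>i. i < k \<Longrightarrow> c i \<in> range u"
    "\<And>(\<phi> :: real \<Rightarrow> real) \<rho>. finite_measure \<rho> \<Longrightarrow> sets \<rho> = sets borel \<Longrightarrow>
      (\<integral>x. \<phi> (u x) \<partial>\<rho>) = (\<Sum>i<k. \<phi> (c i) * measure \<rho> (A i))"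
proof -
  have um: "u \<in> borel_measurable borel" by (rule borel_measurable_simple_function[OF u])
  have fin: "finite (range u)" using u by (simp add: simple_function_def)
  from ex_bij_betw_nat_finite[OF fin] obtain c where c: "bij_betw c {..<card (range u)} (range u)"
    by (auto simp: atLeast0LessThan)
  define k where "k = card (range u)"
  define A where "A i = u -` {c i}" for i
  have A: "A i \<in> sets borel" for i
    using measurable_sets[OF um, of "{c i}"] by (simp add: A_def)
  have disj: "disjoint_family_on A {..<k}"
    using c by (auto simp: disjoint_family_on_def A_def k_def bij_betw_def inj_on_def)
  have rep: "\<phi> (u x) = (\<Sum>i<k. \<phi> (c i) * indicator (A i) x)" for \<phi> :: "real \<Rightarrow> real" and x
  proof -
    have "u x \<in> c ` {..<k}" using c by (auto simp: bij_betw_def k_def)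
    then obtain j where j: "j < k" "u x = c j" by auto
    have "(\<Sum>i<k. \<phi> (c i) * indicator (A i) x) = (\<Sum>i<k. if i = j then \<phi> (c i) else 0)"
    proof (rule sum.cong)
      fix i assume "i \<in> {..<k}"
      with j c have "c j = c i \<longleftrightarrow> i = j" by (auto simp: bij_betw_def k_def inj_on_def)
      then show "\<phi> (c i) * indicator (A i) x = (if i = j then \<phi> (c i) else 0)"
        using j by (simp add: A_def indicator_def)
    qed simp
    also have "\<dots> = \<phi> (u x)" using j by simp
    finally show ?thesis by simp
  qed
  show thesis
  proof (rule that[of A k c])
    show "(\<Union>i<k. A i) = UNIV" using c by (force simp: A_def k_def bij_betw_def)
    show "c i \<in> range u" if "i < k" for i using c that by (auto simp: bij_betw_def k_def)
    fix \<phi> :: "real \<Rightarrow> real" and \<rho> :: "real measure"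
    assume \<rho>: "finite_measure \<rho>" "sets \<rho> = sets borel"
    interpret finite_measure \<rho> by fact
    have [simp]: "integrable \<rho> (indicat_real (A i))" for i
      using A[of i] \<rho> by (auto intro!: integrable_real_indicator simp: less_top[symmetric])
    have [simp]: "space \<rho> = UNIV" using sets_eq_imp_space_eq[OF \<rho>(2)] by simp
    show "(\<integral>x. \<phi> (u x) \<partial>\<rho>) = (\<Sum>i<k. \<phi> (c i) * measure \<rho> (A i))"
      unfolding rep by (subst Bochner_Integration.integral_sum) auto
  qed (use A disj in auto)
qed

lemma bounded_simple_limit:
  fixes h :: "real \<Rightarrow> real"
  assumes h: "h \<in> borel_measurable borel" and K: "\<And>x. \<bar>h x\<bar> \<le> K"
  obtains F :: "nat \<Rightarrow> real \<Rightarrow> real" where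
    "\<And>i. simple_function borel (F i)" "\<And>i x. \<bar>F i x\<bar> \<le> 2 * K"
    "\<And>(\<phi> :: real \<Rightarrow> real) \<rho>. continuous_on UNIV \<phi> \<Longrightarrow> finite_measure \<rho> \<Longrightarrow> sets \<rho> = sets borel \<Longrightarrow>
      (\<lambda>i. \<integral>x. \<phi> (F i x) \<partial>\<rho>) \<longlonglongrightarrow> (\<integral>x. \<phi> (h x) \<partial>\<rho>)"
proof -
  from borel_measurable_implies_sequence_metric[OF h, of 0]
  obtain F where F: "\<And>i. simple_function borel (F i)" "\<And>x. (\<lambda>i. F i x) \<longlonglongrightarrow> h x"
    "\<And>i x. \<bar>F i x\<bar> \<le> 2 * \<bar>h x\<bar>" by (auto simp: dist_real_def)
  have FK: "\<bar>F i x\<bar> \<le> 2 * K" for i x using F(3)[of i x] K[of x] by linarith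
  show thesis
  proof (rule that[of F])
    fix \<phi> :: "real \<Rightarrow> real" and \<rho> :: "real measure"
    assume \<phi>: "continuous_on UNIV \<phi>" and \<rho>: "finite_measure \<rho>" "sets \<rho> = sets borel"
    interpret finite_measure \<rho> by fact
    note [measurable_cong] = \<rho>(2)
    note [measurable] = h borel_measurable_simple_function[OF F(1)] borel_measurable_continuous_onI[OF \<phi>]
    have "compact (\<phi> ` {-2 * K..2 * K})"
      by (intro compact_continuous_image continuous_on_subset[OF \<phi>]) auto
    then have "bounded (\<phi> ` {-2 * K..2 * K})" by (rule compact_imp_bounded)
    then obtain B where B: "\<And>y. y \<in> {-2 * K..2 * K} \<Longrightarrow> norm (\<phi> y) \<le> B"
      unfolding bounded_iff by blast
    show "(\<lambda>i. \<integral>x. \<phi> (F i x) \<partial>\<rho>) \<longlonglongrightarrow> (\<integral>x. \<phi> (h x) \<partial>\<rho>)"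
    proof (rule integral_dominated_convergence[where w = "\<lambda>_. B"])
      show "AE x in \<rho>. (\<lambda>i. \<phi> (F i x)) \<longlonglongrightarrow> \<phi> (h x)"
        using \<phi> F(2) by (intro AE_I2 continuous_on_tendsto_compose[OF \<phi>]) auto
      show "AE x in \<rho>. norm (\<phi> (F i x)) \<le> B" for i
      proof (rule AE_I2)
        fix x show "norm (\<phi> (F i x)) \<le> B" using FK[of i x] by (intro B) (auto simp: abs_le_iff)
      qed
    qed auto
  qed (use F FK in auto)
qed

lemma integral_of_measure_sum:
  fixes h :: "real \<Rightarrow> real"
  assumes fin: "finite_measure \<rho>" "finite_measure \<nu>" "finite_measure \<mu>"
    and sets: "sets \<rho> = sets borel" "sets \<nu> = sets borel" "sets \<mu> = sets borel"
    and eq: "\<And>A. A \<in> sets borel \<Longrightarrow> measure \<rho> A = measure \<nu> A + r * measure \<mu> A"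
    and h: "h \<in> borel_measurable borel" "\<And>x. \<bar>h x\<bar> \<le> K"
  shows "(\<integral>x. h x \<partial>\<rho>) = (\<integral>x. h x \<partial>\<nu>) + r * (\<integral>x. h x \<partial>\<mu>)"
proof -
  from h obtain F where F: "\<And>i. simple_function borel (F i)"
    and lim: "\<And>(\<phi> :: real \<Rightarrow> real) \<rho>. continuous_on UNIV \<phi> \<Longrightarrow> finite_measure \<rho> \<Longrightarrow> sets \<rho> = sets borel \<Longrightarrow>
      (\<lambda>i. \<integral>x. \<phi> (F i x) \<partial>\<rho>) \<longlonglongrightarrow> (\<integral>x. \<phi> (h x) \<partial>\<rho>)"
    by (rule bounded_simple_limit) (rule that; assumption)
  note lim = lim[of "\<lambda>x. x"]
  have "(\<integral>x. F i x \<partial>\<rho>) = (\<integral>x. F i x \<partial>\<nu>) + r * (\<integral>x. F i x \<partial>\<mu>)" for i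
  proof (rule simple_function_partition[OF F[of i]])
    fix k :: nat and c :: "nat \<Rightarrow> real" and A :: "nat \<Rightarrow> real set"
    assume A: "\<And>j. A j \<in> sets borel" and
      int: "\<And>(\<phi> :: real \<Rightarrow> real) \<rho>. finite_measure \<rho> \<Longrightarrow> sets \<rho> = sets borel \<Longrightarrow>
        (\<integral>x. \<phi> (F i x) \<partial>\<rho>) = (\<Sum>i<k. \<phi> (c i) * measure \<rho> (A i))"
    show "(\<integral>x. F i x \<partial>\<rho>) = (\<integral>x. F i x \<partial>\<nu>) + r * (\<integral>x. F i x \<partial>\<mu>)"
      unfolding int[OF fin(1) sets(1), of "\<lambda>x. x"] int[OF fin(2) sets(2), of "\<lambda>x. x"]
        int[OF fin(3) sets(3), of "\<lambda>x. x"]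
      by (simp add: eq A sum.distrib sum_distrib_left distrib_left mult_ac)
  qed
  moreover have "(\<lambda>i. (\<integral>x. F i x \<partial>\<nu>) + r * (\<integral>x. F i x \<partial>\<mu>)) \<longlonglongrightarrow> (\<integral>x. h x \<partial>\<nu>) + r * (\<integral>x. h x \<partial>\<mu>)"
    using fin sets by (intro tendsto_intros lim) auto
  ultimately show ?thesis
    using lim[OF _ fin(1) sets(1)] by (simp add: LIMSEQ_unique)
qed

text \<open>
  For a simple function this is the estimate for Dirichlet vectors. Both sides are continuous
  under bounded pointwise limits. The approximating simple functions are bounded by \<open>2 * K\<close>, which
  is why \<open>2 * K\<close> appears.
\<close>

lemma dirichlet_process_laplace:
  fixes h :: "real \<Rightarrow> real" and \<alpha> :: "real measure"
  assumes D: "is_dirichlet_process \<alpha> D" and \<alpha>: "finite_measure \<alpha>" "sets \<alpha> = sets borel"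
    and h: "h \<in> borel_measurable borel" "\<And>x. \<bar>h x\<bar> \<le> K"
    and \<delta>: "0 < \<delta>" "\<delta> \<le> 1 / 2"
  defines "N \<equiv> measure \<alpha> UNIV"
  defines "m1 \<equiv> \<integral>x. h x \<partial>\<alpha>"
  defines "m2 \<equiv> \<integral>x. (h x)\<^sup>2 \<partial>\<alpha>"
  assumes N: "0 < N" and small: "3 * (\<bar>s / N\<bar> * (2 * K)) \<le> 1 / 2"
  shows "\<bar>(\<integral>P. exp (s * (\<integral>x. h x \<partial>P)) \<partial>D) - exp (s / N * m1 + (s / N)\<^sup>2 * m2 / 2)\<bar>
    \<le> laplace_error \<delta> s N (2 * K) m1"
proof -
  have setsD: "sets D = sets (prob_algebra borel)" and probD: "prob_space D"
    using D by (auto simp: is_dirichlet_process_def space_prob_algebra)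
  interpret D: prob_space D by (rule probD)
  note [measurable_cong] = setsD
  have PD: "finite_measure P" "sets P = sets borel" "prob_space P" if "P \<in> space D" for P
    using that sets_eq_imp_space_eq[OF setsD]
    by (auto simp: space_prob_algebra prob_space.finite_measure)
  from h obtain F where F: "\<And>i. simple_function borel (F i)" and F2: "\<And>i x. \<bar>F i x\<bar> \<le> 2 * K"
    and lim: "\<And>(\<phi> :: real \<Rightarrow> real) \<rho>. continuous_on UNIV \<phi> \<Longrightarrow> finite_measure \<rho> \<Longrightarrow> sets \<rho> = sets borel \<Longrightarrow>
      (\<lambda>i. \<integral>x. \<phi> (F i x) \<partial>\<rho>) \<longlonglongrightarrow> (\<integral>x. \<phi> (h x) \<partial>\<rho>)"
    by (rule bounded_simple_limit) (rule that; assumption)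
  note [measurable] = h(1) borel_measurable_simple_function[OF F]
  have meas [measurable]: "(\<lambda>P. \<integral>x. f x \<partial>P) \<in> borel_measurable D"
    if [measurable]: "f \<in> borel_measurable borel" for f :: "real \<Rightarrow> real"
  proof -
    have "(\<lambda>P. \<integral>x. f x \<partial>P) \<in> borel_measurable (prob_algebra borel)"
      unfolding prob_algebra_def by (intro measurable_restrict_space1) measurable
    then show ?thesis by measurable
  qed
  have simple: "\<bar>(\<integral>P. exp (s * (\<integral>x. F i x \<partial>P)) \<partial>D) -
      exp (s / N * (\<integral>x. F i x \<partial>\<alpha>) + (s / N)\<^sup>2 * (\<integral>x. (F i x)\<^sup>2 \<partial>\<alpha>) / 2)\<bar>
      \<le> laplace_error \<delta> s N (2 * K) (\<integral>x. F i x \<partial>\<alpha>)" for i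
  proof (rule simple_function_partition[OF F[of i]])
    fix k :: nat and c :: "nat \<Rightarrow> real" and A :: "nat \<Rightarrow> real set"
    assume A: "\<And>j. A j \<in> sets borel" "disjoint_family_on A {..<k}" "(\<Union>i<k. A i) = UNIV"
      and c: "\<And>j. j < k \<Longrightarrow> c j \<in> range (F i)"
      and int: "\<And>(\<phi> :: real \<Rightarrow> real) \<rho>. finite_measure \<rho> \<Longrightarrow> sets \<rho> = sets borel \<Longrightarrow>
        (\<integral>x. \<phi> (F i x) \<partial>\<rho>) = (\<Sum>i<k. \<phi> (c i) * measure \<rho> (A i))"
    define a where "a j = measure \<alpha> (A j)" for j
    have "measure \<alpha> (space \<alpha>) = N" using sets_eq_imp_space_eq[OF \<alpha>(2)] by (simp add: N_def)
    then have Na: "N = (\<Sum>j<k. a j)"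
      using int[OF \<alpha>, of "\<lambda>_. 1"] by (simp add: a_def)
    have m1: "(\<integral>x. F i x \<partial>\<alpha>) = (\<Sum>j<k. a j * c j)"
      using int[OF \<alpha>, of "\<lambda>x. x"] by (simp add: a_def mult.commute)
    have m2: "(\<integral>x. (F i x)\<^sup>2 \<partial>\<alpha>) = (\<Sum>j<k. a j * (c j)\<^sup>2)"
      using int[OF \<alpha>, of "\<lambda>x. x\<^sup>2"] by (simp add: a_def mult.commute)
    have [measurable]: "A j \<in> sets borel" for j by (rule A)
    have "(\<integral>P. exp (s * (\<integral>x. F i x \<partial>P)) \<partial>D) = (\<integral>P. exp (s * (\<Sum>j<k. c j * measure P (A j))) \<partial>D)"
      by (intro Bochner_Integration.integral_cong refl) (simp add: int[OF PD(1,2), of _ "\<lambda>x. x"])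
    also have "\<dots> = (\<integral>x. exp (s * (\<Sum>j<k. c j * x j))
        \<partial>distr D (\<Pi>\<^sub>M j\<in>{..<k}. borel) (\<lambda>P. \<lambda>j\<in>{..<k}. measure P (A j)))"
      by (subst integral_distr) (auto intro!: measurable_restrict Bochner_Integration.integral_cong arg_cong[of _ _ exp] sum.cong arg_cong2[of _ _ _ _ "(*)"])
    also have "distr D (\<Pi>\<^sub>M j\<in>{..<k}. borel) (\<lambda>P. \<lambda>j\<in>{..<k}. measure P (A j)) = dirichlet_distr k a"
      using D A unfolding is_dirichlet_process_def a_def by blast
    finally have E: "(\<integral>P. exp (s * (\<integral>x. F i x \<partial>P)) \<partial>D) = (\<integral>x. exp (s * (\<Sum>j<k. c j * x j)) \<partial>dirichlet_distr k a)" .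
    have cK: "\<bar>c j\<bar> \<le> 2 * K" if "j < k" for j using c[OF that] F2 by auto
    show "\<bar>(\<integral>P. exp (s * (\<integral>x. F i x \<partial>P)) \<partial>D) -
        exp (s / N * (\<integral>x. F i x \<partial>\<alpha>) + (s / N)\<^sup>2 * (\<integral>x. (F i x)\<^sup>2 \<partial>\<alpha>) / 2)\<bar>
        \<le> laplace_error \<delta> s N (2 * K) (\<integral>x. F i x \<partial>\<alpha>)"
      unfolding E m1 m2 Na
      by (rule dirichlet_laplace[OF _ cK \<delta>]) (use N small in \<open>auto simp: a_def Na\<close>)
  qed
  have "(\<lambda>i. \<integral>P. exp (s * (\<integral>x. F i x \<partial>P)) \<partial>D) \<longlonglongrightarrow> (\<integral>P. exp (s * (\<integral>x. h x \<partial>P)) \<partial>D)"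
  proof (rule integral_dominated_convergence[where w = "\<lambda>_. exp (\<bar>s\<bar> * (2 * K))"])
    show "AE P in D. (\<lambda>i. exp (s * (\<integral>x. F i x \<partial>P))) \<longlonglongrightarrow> exp (s * (\<integral>x. h x \<partial>P))"
      by (intro AE_I2 tendsto_intros lim[of "\<lambda>x. x"] PD) auto
    show "AE P in D. norm (exp (s * (\<integral>x. F i x \<partial>P))) \<le> exp (\<bar>s\<bar> * (2 * K))" for i
    proof (rule AE_I2)
      fix P assume P: "P \<in> space D"
      interpret P: prob_space P by (rule PD(3)[OF P])
      note [measurable_cong] = PD(2)[OF P]
      have "\<bar>\<integral>x. F i x \<partial>P\<bar> \<le> (\<integral>x. \<bar>F i x\<bar> \<partial>P)" by (rule integral_abs_bound)
      also have "\<dots> \<le> 2 * K"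
        by (rule P.integral_le_const) (auto intro!: F2 P.integrable_const_bound[of _ "2 * K"])
      finally have "\<bar>s * (\<integral>x. F i x \<partial>P)\<bar> \<le> \<bar>s\<bar> * (2 * K)" by (simp add: abs_mult mult_left_mono)
      then show "norm (exp (s * (\<integral>x. F i x \<partial>P))) \<le> exp (\<bar>s\<bar> * (2 * K))" by simp
    qed
  qed auto
  moreover have l1: "(\<lambda>i. \<integral>x. F i x \<partial>\<alpha>) \<longlonglongrightarrow> m1" unfolding m1_def by (rule lim[OF _ \<alpha>]) simp
  moreover have "(\<lambda>i. \<integral>x. (F i x)\<^sup>2 \<partial>\<alpha>) \<longlonglongrightarrow> m2"
    unfolding m2_def by (rule lim[OF _ \<alpha>]) (intro continuous_intros)
  ultimately have "(\<lambda>i. \<bar>(\<integral>P. exp (s * (\<integral>x. F i x \<partial>P)) \<partial>D) -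
      exp (s / N * (\<integral>x. F i x \<partial>\<alpha>) + (s / N)\<^sup>2 * (\<integral>x. (F i x)\<^sup>2 \<partial>\<alpha>) / 2)\<bar>) \<longlonglongrightarrow>
      \<bar>(\<integral>P. exp (s * (\<integral>x. h x \<partial>P)) \<partial>D) - exp (s / N * m1 + (s / N)\<^sup>2 * m2 / 2)\<bar>"
    by (intro tendsto_intros) auto
  moreover have "(\<lambda>i. laplace_error \<delta> s N (2 * K) (\<integral>x. F i x \<partial>\<alpha>)) \<longlonglongrightarrow> laplace_error \<delta> s N (2 * K) m1"
    unfolding laplace_error_def by (intro tendsto_intros l1)
  ultimately show ?thesis
    using simple by (intro LIMSEQ_le) auto
qed

section \<open>The posterior Laplace transform\<close>

lemma measure_posterior_base:
  assumes \<nu>: "finite_measure \<nu>" "sets \<nu> = sets borel" and n: "n \<ge> 1"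
  shows "sets (posterior_base \<nu> n z) = sets borel"
    and "finite_measure (posterior_base \<nu> n z)"
    and "A \<in> sets borel \<Longrightarrow> measure (posterior_base \<nu> n z) A =
      measure \<nu> A + real n * measure (empirical_measure n z) A"
proof -
  interpret \<nu>: finite_measure \<nu> by fact
  interpret \<mu>: prob_space "empirical_measure n z" by (rule prob_space_empirical_measure[OF n])
  show sets: "sets (posterior_base \<nu> n z) = sets borel"
    by (simp add: posterior_base_def \<nu>)
  have e: "emeasure (posterior_base \<nu> n z) A =
      ennreal (measure \<nu> A + real n * measure (empirical_measure n z) A)" if "A \<in> sets borel" for A
    unfolding posterior_base_def using that \<nu>
    by (subst emeasure_add_measure)
      (simp_all add: \<nu>.emeasure_eq_measure \<mu>.emeasure_eq_measure ennreal_of_nat_eq_real_of_nat ennreal_mult')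
  show "measure (posterior_base \<nu> n z) A = measure \<nu> A + real n * measure (empirical_measure n z) A"
    if "A \<in> sets borel"
    unfolding measure_def[of "posterior_base \<nu> n z"] e[OF that] by (rule enn2real_ennreal) simp
  show "finite_measure (posterior_base \<nu> n z)"
    using e[of UNIV] sets_eq_imp_space_eq[OF sets] by (intro finite_measureI) simp
qed

lemma abs_integral_le_of_bounded:
  fixes f :: "real \<Rightarrow> real"
  assumes \<rho>: "finite_measure \<rho>" "sets \<rho> = sets borel" and f: "f \<in> borel_measurable borel" "\<And>x. \<bar>f x\<bar> \<le> K"
  shows "integrable \<rho> f" and "\<bar>\<integral>x. f x \<partial>\<rho>\<bar> \<le> K * measure \<rho> UNIV"
proof -
  interpret finite_measure \<rho> by fact
  note [measurable_cong] = \<rho>(2) note [measurable] = f(1)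
  have [simp]: "space \<rho> = UNIV" using sets_eq_imp_space_eq[OF \<rho>(2)] by simp
  show i: "integrable \<rho> f"
    by (rule integrable_const_bound[of _ K]) (use f(2) in auto)
  have "\<bar>\<integral>x. f x \<partial>\<rho>\<bar> \<le> (\<integral>x. \<bar>f x\<bar> \<partial>\<rho>)" by (rule integral_abs_bound)
  also have "\<dots> \<le> (\<integral>x. K \<partial>\<rho>)" by (intro integral_mono) (use i f in auto)
  finally show "\<bar>\<integral>x. f x \<partial>\<rho>\<bar> \<le> K * measure \<rho> UNIV" by (simp add: mult.commute)
qed

lemma prob_space_borel_UNIV:
  assumes "prob_space \<rho>" "sets \<rho> = sets (borel :: real measure)" shows "measure \<rho> UNIV = 1"
  using prob_space.prob_space[OF assms(1)] sets_eq_imp_space_eq[OF assms(2)] by simp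

lemma oscillation_le:
  fixes g v :: "real \<Rightarrow> real"
  assumes v: "\<And>x. 0 \<le> v x" "\<And>x. v x \<le> K"
    and gv: "\<And>x y. x \<le> y \<Longrightarrow> \<bar>g y - g x\<bar> \<le> v y - v x"
  shows "\<bar>g x - g y\<bar> \<le> K"
proof (cases "x \<le> y")
  case True
  then show ?thesis using gv[of x y] v(1)[of x] v(2)[of y] by (simp add: abs_minus_commute)
next
  case False
  then show ?thesis using gv[of y x] v(1)[of y] v(2)[of x] by simp
qed

lemma centred_bound:
  fixes g :: "real \<Rightarrow> real"
  assumes \<mu>: "prob_space \<mu>" "sets \<mu> = sets borel" and g: "g \<in> borel_measurable borel"
    and osc: "\<And>x y. \<bar>g x - g y\<bar> \<le> K"
  shows "integrable \<mu> g" "\<bar>g x - (\<integral>y. g y \<partial>\<mu>)\<bar> \<le> K"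
proof -
  interpret prob_space \<mu> by fact
  have [measurable]: "g \<in> borel_measurable borel" by fact
  have i: "integrable \<mu> (\<lambda>y. g x - g y)" and le: "\<bar>\<integral>y. g x - g y \<partial>\<mu>\<bar> \<le> K" for x
    using abs_integral_le_of_bounded[of \<mu> "\<lambda>y. g x - g y" K] \<mu> osc finite_measure_axioms
    by (simp_all add: prob_space_borel_UNIV)
  have "integrable \<mu> (\<lambda>y. g x - (g x - g y))" by (intro Bochner_Integration.integrable_diff i) auto
  then show ig: "integrable \<mu> g" by simp
  have "(\<integral>y. g x - g y \<partial>\<mu>) = g x - (\<integral>y. g y \<partial>\<mu>)"
    using ig by (simp add: prob_space)
  with le[of x] show "\<bar>g x - (\<integral>y. g y \<partial>\<mu>)\<bar> \<le> K" by simp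
qed

text \<open>
  Shifting \<open>g\<close> so that it vanishes at \<open>0\<close> leaves the variance unchanged and bounds \<open>g\<close> by \<open>K\<close>. The
  square then has the majorant \<open>2 * K * v\<close>, so both moments in the variance are controlled by the
  Kolmogorov--Smirnov distance.
\<close>

lemma variance_ks:
  fixes g v :: "real \<Rightarrow> real"
  assumes \<mu>: "prob_space \<mu>" "sets \<mu> = sets borel" and \<pi>: "prob_space \<pi>" "sets \<pi> = sets borel"
    and v: "\<And>x. 0 \<le> v x" "\<And>x. v x \<le> K"
    and gv: "\<And>x y. x \<le> y \<Longrightarrow> \<bar>g y - g x\<bar> \<le> v y - v x"
  shows "\<bar>(\<integral>x. (g x - (\<integral>y. g y \<partial>\<mu>))\<^sup>2 \<partial>\<mu>) - (\<integral>x. (g x - (\<integral>y. g y \<partial>\<pi>))\<^sup>2 \<partial>\<pi>)\<bar>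
    \<le> 16 * K\<^sup>2 * ks_distance \<mu> \<pi>"
proof -
  have K: "0 \<le> K" using v[of 0] by linarith
  note gm [measurable] = measurable_of_majorant[OF gv]
  have osc: "\<bar>g x - g y\<bar> \<le> K" for x y by (rule oscillation_le[OF v gv])
  define f where "f x = g x - g 0" for x
  have [measurable]: "f \<in> borel_measurable borel" unfolding f_def by measurable
  have fK: "\<bar>f x\<bar> \<le> K" for x using osc[of x 0] by (simp add: f_def)
  have f2K: "\<bar>(f x)\<^sup>2\<bar> \<le> K\<^sup>2" for x using fK[of x] K by (simp add: abs_le_square_iff[symmetric])
  have var: "(\<integral>x. (g x - (\<integral>y. g y \<partial>\<rho>))\<^sup>2 \<partial>\<rho>) = (\<integral>x. (f x)\<^sup>2 \<partial>\<rho>) - (\<integral>x. f x \<partial>\<rho>)\<^sup>2"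
    and mean: "\<bar>\<integral>x. f x \<partial>\<rho>\<bar> \<le> K"
    if \<rho>: "prob_space \<rho>" "sets \<rho> = sets borel" for \<rho>
  proof -
    interpret prob_space \<rho> by fact
    note b = abs_integral_le_of_bounded[OF finite_measure_axioms \<rho>(2)]
    have fi: "integrable \<rho> f" by (rule b(1)[OF _ fK]) measurable
    have f2i: "integrable \<rho> (\<lambda>x. (f x)\<^sup>2)" by (rule b(1)[OF _ f2K]) measurable
    show "\<bar>\<integral>x. f x \<partial>\<rho>\<bar> \<le> K" using b(2)[of f K] fK by (simp add: prob_space_borel_UNIV \<rho>)
    have gi: "integrable \<rho> g" by (rule centred_bound(1)[OF \<rho> gm osc])
    have m: "(\<integral>x. f x \<partial>\<rho>) = (\<integral>x. g x \<partial>\<rho>) - g 0" using gi by (simp add: f_def[abs_def] prob_space)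
    have "g x - (\<integral>y. g y \<partial>\<rho>) = f x - (\<integral>x. f x \<partial>\<rho>)" for x
      using m f_def[of x] by linarith
    then have "(g x - (\<integral>y. g y \<partial>\<rho>))\<^sup>2 = (f x)\<^sup>2 - 2 * (\<integral>x. f x \<partial>\<rho>) * f x + (\<integral>x. f x \<partial>\<rho>)\<^sup>2" for x
      by (simp add: power2_diff)
    then have "(\<integral>x. (g x - (\<integral>y. g y \<partial>\<rho>))\<^sup>2 \<partial>\<rho>) =
        (\<integral>x. (f x)\<^sup>2 - 2 * (\<integral>x. f x \<partial>\<rho>) * f x + (\<integral>x. f x \<partial>\<rho>)\<^sup>2 \<partial>\<rho>)" by simp
    also have "\<dots> = (\<integral>x. (f x)\<^sup>2 \<partial>\<rho>) - 2 * (\<integral>x. f x \<partial>\<rho>) * (\<integral>x. f x \<partial>\<rho>) + (\<integral>x. f x \<partial>\<rho>)\<^sup>2"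
      using fi f2i by (simp add: prob_space)
    finally show "(\<integral>x. (g x - (\<integral>y. g y \<partial>\<rho>))\<^sup>2 \<partial>\<rho>) = (\<integral>x. (f x)\<^sup>2 \<partial>\<rho>) - (\<integral>x. f x \<partial>\<rho>)\<^sup>2"
      by (simp add: power2_eq_square)
  qed
  have fv: "\<bar>f y - f x\<bar> \<le> v y - v x" if "x \<le> y" for x y using gv[OF that] by (simp add: f_def)
  have ks1: "\<bar>(\<integral>x. f x \<partial>\<mu>) - (\<integral>x. f x \<partial>\<pi>)\<bar> \<le> 4 * K * ks_distance \<mu> \<pi>"
    by (rule integral_majorant_ks[OF \<mu> \<pi> v fv fK])
  have ks2: "\<bar>(\<integral>x. (f x)\<^sup>2 \<partial>\<mu>) - (\<integral>x. (f x)\<^sup>2 \<partial>\<pi>)\<bar> \<le> 4 * (2 * K\<^sup>2) * ks_distance \<mu> \<pi>"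
  proof (rule integral_majorant_ks[OF \<mu> \<pi>, where v = "\<lambda>x. 2 * K * v x"])
    show "0 \<le> 2 * K * v x" for x using K v by simp
    show "2 * K * v x \<le> 2 * K\<^sup>2" for x
      using mult_left_mono[OF v(2)[of x] K] by (simp add: power2_eq_square)
    show "\<bar>(f y)\<^sup>2 - (f x)\<^sup>2\<bar> \<le> 2 * K * v y - 2 * K * v x" if "x \<le> y" for x y
    proof -
      have "\<bar>(f y)\<^sup>2 - (f x)\<^sup>2\<bar> = \<bar>f y + f x\<bar> * \<bar>f y - f x\<bar>"
        unfolding abs_mult[symmetric] by (simp add: power2_eq_square algebra_simps)
      also have "\<dots> \<le> (2 * K) * (v y - v x)"
        using fK[of x] fK[of y] fv[OF that] by (intro mult_mono) auto
      finally show ?thesis by (simp add: algebra_simps)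
    qed
    show "\<bar>(f x)\<^sup>2\<bar> \<le> 2 * K\<^sup>2" for x using f2K[of x] by (smt (verit) zero_le_power2)
  qed
  let ?a = "\<integral>x. f x \<partial>\<mu>" and ?b = "\<integral>x. f x \<partial>\<pi>"
  have "\<bar>?a\<^sup>2 - ?b\<^sup>2\<bar> = \<bar>?a - ?b\<bar> * \<bar>?a + ?b\<bar>"
    unfolding abs_mult[symmetric] by (simp add: power2_eq_square algebra_simps)
  also have "\<dots> \<le> (4 * K * ks_distance \<mu> \<pi>) * (2 * K)"
    using ks1 mean[OF \<mu>] mean[OF \<pi>] by (intro mult_mono) auto
  finally have "\<bar>?a\<^sup>2 - ?b\<^sup>2\<bar> \<le> 8 * (K\<^sup>2 * ks_distance \<mu> \<pi>)" by (simp add: power2_eq_square mult_ac)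
  with ks2 show ?thesis unfolding var[OF \<mu>] var[OF \<pi>] by (simp add: mult.assoc)
qed

text \<open>
  The key estimate for one function and one sample, with a right-hand side that depends on \<open>g\<close> only
  through \<open>K\<close> and on the sample only through the Kolmogorov--Smirnov distance. With \<open>g\<close> centred at its
  empirical mean, the empirical part of the base measure drops out of the first-order term, which
  is therefore of order \<open>1 / sqrt n\<close>; the second-order term is, up to order \<open>1 / n\<close>, half of \<open>t\<^sup>2\<close>
  times the empirical variance.
\<close>

lemma posterior_laplace_bound:
  fixes g v :: "real \<Rightarrow> real" and n :: nat and t \<delta> K :: real and \<nu> \<pi> :: "real measure"
  assumes \<nu>: "finite_measure \<nu>" "sets \<nu> = sets borel" and n: "n \<ge> 1"
    and D: "is_dirichlet_process (posterior_base \<nu> n z) D"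
    and \<pi>: "prob_space \<pi>" "sets \<pi> = sets borel"
    and v: "\<And>x. 0 \<le> v x" "\<And>x. v x \<le> K"
    and gv: "\<And>x y. x \<le> y \<Longrightarrow> \<bar>g y - g x\<bar> \<le> v y - v x"
    and \<delta>: "0 < \<delta>" "\<delta> \<le> 1 / 2" and small: "6 * (\<bar>t\<bar> * K) / sqrt (real n) \<le> 1 / 2"
  defines "V \<equiv> measure \<nu> UNIV"
  defines "\<mu> \<equiv> empirical_measure n z"
  shows "\<bar>(\<integral>P. exp (t * sqrt (real n) * ((\<integral>x. g x \<partial>P) - (\<integral>x. g x \<partial>\<mu>))) \<partial>D) -
      exp (t\<^sup>2 * (\<integral>x. (g x - (\<integral>y. g y \<partial>\<pi>))\<^sup>2 \<partial>\<pi>) / 2)\<bar> \<le>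
    ((6 * \<delta> + 16 * (\<bar>t\<bar> * K) ^ 3 / sqrt (real n)) * exp (3 * (\<bar>t\<bar> * K * V) + 72 * (t * K)\<^sup>2) +
     2 * (exp (2 * (\<bar>t\<bar> * K) * sqrt (real n)) + 1 / \<delta>) * exp (- real n * \<delta>\<^sup>2 / 8)) +
    (\<bar>t\<bar> * K * V / sqrt (real n) + t\<^sup>2 * K\<^sup>2 * (3 * V / real n + 16 * ks_distance \<mu> \<pi>) / 2) *
      exp (\<bar>t\<bar> * K * V + (t * K)\<^sup>2)"
proof -
  have K: "0 \<le> K" using v[of 0] by linarith
  have n0: "0 < real n" using n by simp
  define r where "r = sqrt (real n)"
  have r: "r > 0" "r * r = real n" "r \<ge> 1" using n by (auto simp: r_def)
  note gm [measurable] = measurable_of_majorant[OF gv]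
  have osc: "\<bar>g x - g y\<bar> \<le> K" for x y by (rule oscillation_le[OF v gv])
  have \<mu>: "prob_space \<mu>" "sets \<mu> = sets borel" using prob_space_empirical_measure[OF n] by (auto simp: \<mu>_def)
  define h where "h x = g x - (\<integral>y. g y \<partial>\<mu>)" for x
  have hm [measurable]: "h \<in> borel_measurable borel" unfolding h_def by measurable
  have hK: "\<bar>h x\<bar> \<le> K" for x unfolding h_def by (rule centred_bound(2)[OF \<mu> gm osc])
  have h2m: "(\<lambda>x. (h x)\<^sup>2) \<in> borel_measurable borel" by measurable
  have h2K: "\<bar>(h x)\<^sup>2\<bar> \<le> K\<^sup>2" for x using hK[of x] K by (simp add: abs_le_square_iff[symmetric])
  define \<alpha> where "\<alpha> = posterior_base \<nu> n z"
  note \<alpha> = measure_posterior_base[OF \<nu> n, where z = z, folded \<alpha>_def \<mu>_def]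
  define N where "N = measure \<alpha> UNIV"
  define m1 where "m1 = (\<integral>x. h x \<partial>\<alpha>)"
  define m2 where "m2 = (\<integral>x. (h x)\<^sup>2 \<partial>\<alpha>)"
  have V: "0 \<le> V" by (simp add: V_def)
  have N: "N = V + real n" unfolding N_def V_def by (simp add: \<alpha> prob_space_borel_UNIV[OF \<mu>])
  have Nn: "real n \<le> N" "0 < N" using V n0 by (auto simp: N)
  note fin\<mu> = prob_space.finite_measure[OF \<mu>(1)]
  have "(\<integral>x. h x \<partial>\<mu>) = 0"
  proof -
    interpret prob_space \<mu> by (rule \<mu>)
    show ?thesis using centred_bound(1)[OF \<mu> gm osc] by (simp add: h_def prob_space)
  qed
  then have m1: "m1 = (\<integral>x. h x \<partial>\<nu>)"
    unfolding m1_def by (subst integral_of_measure_sum[OF \<alpha>(2) \<nu>(1) fin\<mu> \<alpha>(1) \<nu>(2) \<mu>(2) \<alpha>(3) hm hK]) auto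
  then have m1_le: "\<bar>m1\<bar> \<le> K * V"
    unfolding V_def using abs_integral_le_of_bounded(2)[OF \<nu> hm hK] by simp
  define p where "p = (\<integral>x. (h x)\<^sup>2 \<partial>\<nu>)"
  define q where "q = (\<integral>x. (h x)\<^sup>2 \<partial>\<mu>)"
  have m2: "m2 = p + real n * q"
    unfolding m2_def p_def q_def
    by (rule integral_of_measure_sum[OF \<alpha>(2) \<nu>(1) fin\<mu> \<alpha>(1) \<nu>(2) \<mu>(2) \<alpha>(3) h2m h2K])
  have p: "0 \<le> p" "p \<le> K\<^sup>2 * V"
    using abs_integral_le_of_bounded(2)[OF \<nu> h2m h2K] by (simp_all add: p_def V_def)
  have q: "0 \<le> q" "q \<le> K\<^sup>2"
    using abs_integral_le_of_bounded(2)[OF fin\<mu> \<mu>(2) h2m h2K] by (simp_all add: q_def prob_space_borel_UNIV[OF \<mu>])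
  define \<sigma> where "\<sigma> = (\<integral>x. (g x - (\<integral>y. g y \<partial>\<pi>))\<^sup>2 \<partial>\<pi>)"
  have q\<sigma>: "\<bar>q - \<sigma>\<bar> \<le> 16 * K\<^sup>2 * ks_distance \<mu> \<pi>"
    unfolding q_def \<sigma>_def h_def by (rule variance_ks[OF \<mu> \<pi> v gv])
  have \<sigma>: "0 \<le> \<sigma>" "\<sigma> \<le> K\<^sup>2"
  proof -
    have c: "\<bar>g x - (\<integral>y. g y \<partial>\<pi>)\<bar> \<le> K" for x by (rule centred_bound(2)[OF \<pi> gm osc])
    have "\<bar>(g x - (\<integral>y. g y \<partial>\<pi>))\<^sup>2\<bar> \<le> K\<^sup>2" for x using c[of x] K by (simp add: abs_le_square_iff[symmetric])
    from abs_integral_le_of_bounded(2)[OF prob_space.finite_measure[OF \<pi>(1)] \<pi>(2) _ this]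
    show "\<sigma> \<le> K\<^sup>2" by (simp add: \<sigma>_def prob_space_borel_UNIV[OF \<pi>])
  qed (simp add: \<sigma>_def)
  define s where "s = t * r"
  define l where "l = s / N"
  have l_le: "\<bar>l\<bar> \<le> \<bar>t\<bar> / r"
  proof -
    have "\<bar>l\<bar> = \<bar>t\<bar> * r / N" using Nn r by (simp add: l_def s_def abs_mult)
    also have "\<dots> \<le> \<bar>t\<bar> * r / (r * r)" using Nn r n0 by (intro divide_left_mono) auto
    finally show ?thesis using r(1) by simp
  qed
  have l2: "N * l\<^sup>2 \<le> t\<^sup>2"
  proof -
    have "N * l\<^sup>2 = t\<^sup>2 * (real n / N)" using Nn r by (simp add: l_def s_def power2_eq_square field_simps)
    also have "\<dots> \<le> t\<^sup>2 * 1" using Nn by (intro mult_left_mono) auto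
    finally show ?thesis by simp
  qed
  have lm1: "\<bar>l * m1\<bar> \<le> \<bar>t\<bar> * K * V / r"
    unfolding abs_mult using mult_mono[OF l_le m1_le] r by (simp add: mult_ac)
  also have "\<dots> \<le> \<bar>t\<bar> * K * V / 1" using r K V by (intro divide_left_mono) auto
  finally have lm1'': "\<bar>l * m1\<bar> \<le> \<bar>t\<bar> * K * V" by simp
  have small': "3 * (\<bar>s / N\<bar> * (2 * K)) \<le> 1 / 2"
  proof -
    have "\<bar>l\<bar> * (6 * K) \<le> \<bar>t\<bar> / r * (6 * K)" using l_le K by (intro mult_right_mono) auto
    also have "\<dots> = 6 * (\<bar>t\<bar> * K) / r" by simp
    also have "\<dots> \<le> 1 / 2" using small by (simp only: r_def)
    finally show ?thesis by (simp add: l_def mult_ac)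
  qed
  have "\<bar>(\<integral>P. exp (s * (\<integral>x. h x \<partial>P)) \<partial>D) - exp (l * m1 + l\<^sup>2 * m2 / 2)\<bar> \<le> laplace_error \<delta> s N (2 * K) m1"
    unfolding l_def N_def m1_def m2_def
    by (rule dirichlet_process_laplace[OF D[folded \<alpha>_def] \<alpha>(2,1) hm hK \<delta>])
      (use Nn small' in \<open>simp_all add: N_def\<close>)
  also have "laplace_error \<delta> s N (2 * K) m1 \<le>
    (6 * \<delta> + 16 * (\<bar>t\<bar> * K) ^ 3 / r) * exp (3 * (\<bar>t\<bar> * K * V) + 72 * (t * K)\<^sup>2) +
     2 * (exp (2 * (\<bar>t\<bar> * K) * r) + 1 / \<delta>) * exp (- real n * \<delta>\<^sup>2 / 8)"
    unfolding laplace_error_def l_def[symmetric]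
  proof (intro add_mono mult_mono)
    have "2 * N * (\<bar>l\<bar> * (2 * K)) ^ 3 = 16 * K ^ 3 * (\<bar>l\<bar> * (N * l\<^sup>2))"
      by (simp add: power3_eq_cube power2_eq_square abs_if)
    also have "\<dots> \<le> 16 * K ^ 3 * ((\<bar>t\<bar> / r) * t\<^sup>2)"
      using K r by (intro mult_left_mono mult_mono l_le l2) (use Nn in auto)
    also have "\<dots> = 16 * (\<bar>t\<bar> * K) ^ 3 / r" by (simp add: power3_eq_cube power2_eq_square abs_if)
    finally show "2 * N * (\<bar>l\<bar> * (2 * K)) ^ 3 \<le> 16 * (\<bar>t\<bar> * K) ^ 3 / r" .
    have "18 * N * (l * (2 * K))\<^sup>2 = 72 * K\<^sup>2 * (N * l\<^sup>2)" by (simp add: power2_eq_square)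
    also have "\<dots> \<le> 72 * K\<^sup>2 * t\<^sup>2" by (intro mult_left_mono l2) auto
    finally show "exp (3 * \<bar>l * m1\<bar> + 18 * N * (l * (2 * K))\<^sup>2) \<le> exp (3 * (\<bar>t\<bar> * K * V) + 72 * (t * K)\<^sup>2)"
      using lm1'' by (simp add: power_mult_distrib mult_ac)
    show "exp (\<bar>s\<bar> * (2 * K)) \<le> exp (2 * (\<bar>t\<bar> * K) * r)" using r by (simp add: s_def abs_mult)
    show "exp (- N * \<delta>\<^sup>2 / 8) \<le> exp (- real n * \<delta>\<^sup>2 / 8)" using Nn by (simp add: mult_right_mono)
  qed (use \<delta> K r in \<open>auto intro!: add_nonneg_nonneg\<close>)
  also have "(\<integral>P. exp (s * (\<integral>x. h x \<partial>P)) \<partial>D) =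
      (\<integral>P. exp (t * sqrt (real n) * ((\<integral>x. g x \<partial>P) - (\<integral>x. g x \<partial>\<mu>))) \<partial>D)"
  proof (rule Bochner_Integration.integral_cong)
    fix P assume "P \<in> space D"
    moreover have "sets D = sets (prob_algebra borel)"
      using D by (auto simp: is_dirichlet_process_def space_prob_algebra)
    ultimately have P: "prob_space P" "sets P = sets borel"
      using sets_eq_imp_space_eq[of D] by (auto simp: space_prob_algebra)
    interpret prob_space P by (rule P)
    show "exp (s * (\<integral>x. h x \<partial>P)) = exp (t * sqrt (real n) * ((\<integral>x. g x \<partial>P) - (\<integral>x. g x \<partial>\<mu>)))"
      using centred_bound(1)[OF P gm osc] by (simp add: h_def prob_space s_def r_def)
  qed simp
  finally have step1: "\<bar>(\<integral>P. exp (t * sqrt (real n) * ((\<integral>x. g x \<partial>P) - (\<integral>x. g x \<partial>\<mu>))) \<partial>D) - exp (l * m1 + l\<^sup>2 * m2 / 2)\<bar> \<le>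
    (6 * \<delta> + 16 * (\<bar>t\<bar> * K) ^ 3 / r) * exp (3 * (\<bar>t\<bar> * K * V) + 72 * (t * K)\<^sup>2) +
     2 * (exp (2 * (\<bar>t\<bar> * K) * r) + 1 / \<delta>) * exp (- real n * \<delta>\<^sup>2 / 8)" .
  have l2m2: "\<bar>l\<^sup>2 * m2 - t\<^sup>2 * \<sigma>\<bar> \<le> t\<^sup>2 * (K\<^sup>2 * (3 * V / real n + 16 * ks_distance \<mu> \<pi>))"
  proof -
    have "real n / N\<^sup>2 * p \<le> real n / (real n)\<^sup>2 * (K\<^sup>2 * V)"
      using Nn n0 p by (intro mult_mono divide_left_mono power_mono) auto
    then have 1: "\<bar>real n / N\<^sup>2 * p\<bar> \<le> K\<^sup>2 * (V / real n)"
      using n0 p by (simp add: power2_eq_square)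
    have "N\<^sup>2 - (real n)\<^sup>2 = V * (N + real n)" by (simp add: N power2_eq_square algebra_simps)
    moreover have "1 - (real n)\<^sup>2 / N\<^sup>2 = (N\<^sup>2 - (real n)\<^sup>2) / N\<^sup>2"
      using Nn by (simp add: diff_divide_distrib)
    ultimately have "1 - (real n)\<^sup>2 / N\<^sup>2 = V * (N + real n) / N\<^sup>2" by simp
    also have "\<dots> \<le> V * (N + N) / N\<^sup>2" using Nn V by (intro divide_right_mono mult_left_mono) auto
    also have "\<dots> = 2 * V / N" using Nn by (simp add: power2_eq_square)
    also have "\<dots> \<le> 2 * V / real n" using Nn V n0 by (intro divide_left_mono) auto
    finally have "1 - (real n)\<^sup>2 / N\<^sup>2 \<le> 2 * V / real n" .
    moreover have "(real n)\<^sup>2 / N\<^sup>2 \<le> 1" using Nn n0 by (simp add: power_mono)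
    ultimately have "\<bar>(real n)\<^sup>2 / N\<^sup>2 - 1\<bar> * q \<le> (2 * V / real n) * K\<^sup>2"
      using q V n0 by (intro mult_mono) auto
    then have 2: "\<bar>((real n)\<^sup>2 / N\<^sup>2 - 1) * q\<bar> \<le> K\<^sup>2 * (2 * V / real n)"
      using q by (simp add: abs_mult mult.commute)
    have "l\<^sup>2 * m2 - t\<^sup>2 * \<sigma> = t\<^sup>2 * (real n / N\<^sup>2 * p + ((real n)\<^sup>2 / N\<^sup>2 - 1) * q + (q - \<sigma>))"
    proof -
      have l: "l\<^sup>2 = t\<^sup>2 * (real n / N\<^sup>2)" using r by (simp add: l_def s_def power_mult_distrib power_divide power2_eq_square)
      have c: "(real n)\<^sup>2 / N\<^sup>2 = real n * (real n / N\<^sup>2)" by (simp add: power2_eq_square)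
      have "T * c * (p + m * q) - T * \<sigma> = T * (c * p + (m * c - 1) * q + (q - \<sigma>))" for T c m :: real
        by (simp add: algebra_simps)
      then show ?thesis unfolding m2 l c .
    qed
    then have "\<bar>l\<^sup>2 * m2 - t\<^sup>2 * \<sigma>\<bar> = t\<^sup>2 * \<bar>real n / N\<^sup>2 * p + ((real n)\<^sup>2 / N\<^sup>2 - 1) * q + (q - \<sigma>)\<bar>"
      by (simp add: abs_mult)
    also have "\<dots> \<le> t\<^sup>2 * (K\<^sup>2 * (V / real n) + K\<^sup>2 * (2 * V / real n) + 16 * K\<^sup>2 * ks_distance \<mu> \<pi>)"
      by (intro mult_left_mono order_trans[OF abs_triangle_ineq] add_mono 1 2 q\<sigma>) auto
    also have "\<dots> = t\<^sup>2 * (K\<^sup>2 * (3 * V / real n + 16 * ks_distance \<mu> \<pi>))"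
      using n0 by (simp add: field_simps)
    finally show ?thesis .
  qed
  have step2: "\<bar>exp (l * m1 + l\<^sup>2 * m2 / 2) - exp (t\<^sup>2 * \<sigma> / 2)\<bar> \<le>
      (\<bar>t\<bar> * K * V / r + t\<^sup>2 * K\<^sup>2 * (3 * V / real n + 16 * ks_distance \<mu> \<pi>) / 2) * exp (\<bar>t\<bar> * K * V + (t * K)\<^sup>2)"
  proof (intro order_trans[OF exp_diff_le] mult_mono)
    have split: "\<bar>x + y / 2 - z / 2\<bar> \<le> \<bar>x\<bar> + \<bar>y - z\<bar> / 2" for x y z :: real
      by (auto simp: abs_if field_simps)
    show "\<bar>l * m1 + l\<^sup>2 * m2 / 2 - t\<^sup>2 * \<sigma> / 2\<bar> \<le> \<bar>t\<bar> * K * V / r + t\<^sup>2 * K\<^sup>2 * (3 * V / real n + 16 * ks_distance \<mu> \<pi>) / 2"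
      unfolding mult.assoc[of "t\<^sup>2" "K\<^sup>2"]
      by (rule order_trans[OF split add_mono[OF lm1 divide_right_mono[OF l2m2]]]) simp
    have "m2 \<le> N * K\<^sup>2"
      using p(2) mult_left_mono[OF q(2), of "real n"] unfolding m2 N by (simp add: algebra_simps)
    then have "l\<^sup>2 * m2 \<le> l\<^sup>2 * (N * K\<^sup>2)" by (rule mult_left_mono) simp
    also have "\<dots> \<le> t\<^sup>2 * K\<^sup>2" using mult_right_mono[OF l2, of "K\<^sup>2"] by (simp add: mult_ac)
    finally have a: "l\<^sup>2 * m2 \<le> (t * K)\<^sup>2" by (simp add: power_mult_distrib)
    have b: "t\<^sup>2 * \<sigma> \<le> (t * K)\<^sup>2" using \<sigma> by (simp add: power_mult_distrib mult_left_mono)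
    have "max (x + y / 2) (z / 2) \<le> w + u" if "\<bar>x\<bar> \<le> w" "y \<le> u" "z \<le> u" "0 \<le> u" for x y z w u :: real
      using that by (intro max.boundedI) linarith+
    from this[OF lm1'' a b zero_le_power2]
    show "exp (max (l * m1 + l\<^sup>2 * m2 / 2) (t\<^sup>2 * \<sigma> / 2)) \<le> exp (\<bar>t\<bar> * K * V + (t * K)\<^sup>2)"
      by simp
    show "0 \<le> \<bar>t\<bar> * K * V / r + t\<^sup>2 * K\<^sup>2 * (3 * V / real n + 16 * ks_distance \<mu> \<pi>) / 2"
      using K V r ks_distance_nonneg[OF \<mu>(1) \<pi>(1)] by simp
  qed simp
  have "\<bar>x - z\<bar> \<le> \<bar>x - y\<bar> + \<bar>y - z\<bar>" for x y z :: real by linarith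
  from order_trans[OF this add_mono[OF step1 step2]] show ?thesis
    unfolding r_def \<sigma>_def .
qed

text \<open>
  The choice \<open>\<delta> = n powr (- 1 / 8)\<close> tends to \<open>0\<close> while \<open>n * \<delta>\<^sup>2 = n powr (3 / 4)\<close> still dominates
  \<open>sqrt n\<close>.
\<close>

lemma posterior_laplace_bound_tendsto_0:
  fixes C1 C2 C3 C4 C5 C6 :: real and d :: "nat \<Rightarrow> real"
  assumes C: "0 \<le> C3" and d: "d \<longlonglongrightarrow> 0"
  shows "(\<lambda>n. ((6 * real n powr (- 1 / 8) + 16 * C1 / sqrt (real n)) * C2 +
     2 * (exp (2 * C3 * sqrt (real n)) + 1 / real n powr (- 1 / 8)) * exp (- real n * (real n powr (- 1 / 8))\<^sup>2 / 8)) +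
    (C4 / sqrt (real n) + C5 * (3 * V / real n + 16 * d n) / 2) * C6) \<longlonglongrightarrow> 0"
proof -
  have 1: "(\<lambda>n. (6 * real n powr (- 1 / 8) + 16 * C1 / sqrt (real n)) * C2) \<longlonglongrightarrow> 0"
    by real_asymp
  have 2: "(\<lambda>n. 2 * (exp (2 * C3 * sqrt (real n)) + 1 / real n powr (- 1 / 8)) *
      exp (- real n * (real n powr (- 1 / 8))\<^sup>2 / 8)) \<longlonglongrightarrow> 0"
  proof (cases "C3 = 0")
    case True
    show ?thesis unfolding True by real_asymp
  next
    case False
    with C have "C3 > 0" by simp
    then show ?thesis by real_asymp
  qed
  have 3: "(\<lambda>n. C4 / sqrt (real n)) \<longlonglongrightarrow> 0" "(\<lambda>n. 3 * V / real n) \<longlonglongrightarrow> 0"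
    by real_asymp+
  have "(\<lambda>n. ((6 * real n powr (- 1 / 8) + 16 * C1 / sqrt (real n)) * C2 +
     2 * (exp (2 * C3 * sqrt (real n)) + 1 / real n powr (- 1 / 8)) * exp (- real n * (real n powr (- 1 / 8))\<^sup>2 / 8)) +
    (C4 / sqrt (real n) + C5 * (3 * V / real n + 16 * d n) / 2) * C6) \<longlonglongrightarrow>
    (0 + 0) + (0 + C5 * (0 + 16 * 0) / 2) * C6"
    by (intro tendsto_add tendsto_mult tendsto_const 1 2 3 d tendsto_divide) simp_all
  then show ?thesis by simp
qed

theorem proposition1:
  fixes M :: "'w measure" and Z :: "nat \<Rightarrow> 'w \<Rightarrow> real"
    and P0 \<nu> :: "real measure"
    and DP :: "nat \<Rightarrow> 'w \<Rightarrow> real measure measure"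
    and G :: "(real \<Rightarrow> real) set" and t :: real
  assumes "prob_space M"
    and "prob_space.indep_vars M (\<lambda>_. borel) Z UNIV"
    and "\<And>i. distr M borel (Z i) = P0"
    and "finite_measure \<nu>" and "sets \<nu> = sets borel"
    and "\<And>n \<omega>. n \<ge> 1 \<Longrightarrow> \<omega> \<in> space M \<Longrightarrow>
           is_dirichlet_process (posterior_base \<nu> n (\<lambda>i. Z i \<omega>)) (DP n \<omega>)"
    and "\<And>g x. g \<in> G \<Longrightarrow> continuous (at_right x) g"
    and "(SUP g\<in>G. BV_seminorm g) < \<infinity>"
  shows "AE \<omega> in M.
    (\<lambda>n. SUP g\<in>G. ennreal
       \<bar>(\<integral>P. exp (t * sqrt (real n) *
              ((\<integral>x. g x \<partial>P) - (\<integral>x. g x \<partial>empirical_measure n (\<lambda>i. Z i \<omega>)))) \<partial>DP n \<omega>)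
        - exp (t\<^sup>2 * (\<integral>x. (g x - (\<integral>y. g y \<partial>P0))\<^sup>2 \<partial>P0) / 2)\<bar>)
    \<longlonglongrightarrow> 0"
proof -
  interpret prob_space M by fact
  have [measurable]: "Z i \<in> borel_measurable M" for i
    using assms(2) unfolding indep_vars_def by auto
  have P0: "prob_space P0" "sets P0 = sets borel"
    unfolding assms(3)[of 0, symmetric] by (auto intro: prob_space_distr)
  define K where "K = enn2real (SUP g\<in>G. BV_seminorm g)"
  have K: "0 \<le> K" by (simp add: K_def)
  have BV: "BV_seminorm g \<le> ennreal K" if "g \<in> G" for g
    using SUP_upper[OF that, of BV_seminorm] assms(8) by (simp add: K_def less_top[symmetric])
  define V where "V = measure \<nu> UNIV"
  have "AE \<omega> in M. (\<lambda>n. ks_distance (empirical_measure n (\<lambda>i. Z i \<omega>)) P0) \<longlonglongrightarrow> 0"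
    by (rule glivenko_cantelli[OF assms(1-3)])
  with AE_space show ?thesis
  proof eventually_elim
    case (elim \<omega>)
    let ?\<mu> = "\<lambda>n. empirical_measure n (\<lambda>i. Z i \<omega>)"
    define err where "err n =
     ((6 * real n powr (- 1 / 8) + 16 * (\<bar>t\<bar> * K) ^ 3 / sqrt (real n)) * exp (3 * (\<bar>t\<bar> * K * V) + 72 * (t * K)\<^sup>2) +
     2 * (exp (2 * (\<bar>t\<bar> * K) * sqrt (real n)) + 1 / real n powr (- 1 / 8)) * exp (- real n * (real n powr (- 1 / 8))\<^sup>2 / 8)) +
    (\<bar>t\<bar> * K * V / sqrt (real n) + t\<^sup>2 * K\<^sup>2 * (3 * V / real n + 16 * ks_distance (?\<mu> n) P0) / 2) *
      exp (\<bar>t\<bar> * K * V + (t * K)\<^sup>2)" for n :: nat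
    have "err \<longlonglongrightarrow> 0"
      unfolding err_def by (rule posterior_laplace_bound_tendsto_0[OF _ elim(2)]) (simp add: K)
    then have lim: "(\<lambda>n. ennreal (err n)) \<longlonglongrightarrow> 0" using tendsto_ennrealI[of err 0] by simp
    have l: "(\<lambda>n. real n powr (- 1 / 8)) \<longlonglongrightarrow> 0" "(\<lambda>n. 6 * (\<bar>t\<bar> * K) / sqrt (real n)) \<longlonglongrightarrow> 0"
      by real_asymp+
    have "eventually (\<lambda>n. real n powr (- 1 / 8) < 1 / 2) sequentially"
        "eventually (\<lambda>n. 6 * (\<bar>t\<bar> * K) / sqrt (real n) < 1 / 2) sequentially"
      using order_tendstoD(2)[OF l(1), of "1 / 2"] order_tendstoD(2)[OF l(2), of "1 / 2"] by auto
    then have ev: "eventually (\<lambda>n. (SUP g\<in>G. ennreal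
       \<bar>(\<integral>P. exp (t * sqrt (real n) * ((\<integral>x. g x \<partial>P) - (\<integral>x. g x \<partial>?\<mu> n))) \<partial>DP n \<omega>)
        - exp (t\<^sup>2 * (\<integral>x. (g x - (\<integral>y. g y \<partial>P0))\<^sup>2 \<partial>P0) / 2)\<bar>) \<le> ennreal (err n)) sequentially"
      using eventually_ge_at_top[of "1 :: nat"]
    proof eventually_elim
      fix n :: nat
      assume \<delta>: "real n powr (- 1 / 8) < 1 / 2" and small: "6 * (\<bar>t\<bar> * K) / sqrt (real n) < 1 / 2" and n: "1 \<le> n"
      show "(SUP g\<in>G. ennreal
       \<bar>(\<integral>P. exp (t * sqrt (real n) * ((\<integral>x. g x \<partial>P) - (\<integral>x. g x \<partial>?\<mu> n))) \<partial>DP n \<omega>)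
        - exp (t\<^sup>2 * (\<integral>x. (g x - (\<integral>y. g y \<partial>P0))\<^sup>2 \<partial>P0) / 2)\<bar>) \<le> ennreal (err n)"
      proof (intro SUP_least ennreal_leI)
        fix g assume "g \<in> G"
        then obtain v where v: "\<And>x. 0 \<le> v x" "\<And>x. v x \<le> K"
          "\<And>x y. x \<le> y \<Longrightarrow> \<bar>g y - g x\<bar> \<le> v y - v x"
          using BV_majorant[OF BV K] by blast
        show "\<bar>(\<integral>P. exp (t * sqrt (real n) * ((\<integral>x. g x \<partial>P) - (\<integral>x. g x \<partial>?\<mu> n))) \<partial>DP n \<omega>)
          - exp (t\<^sup>2 * (\<integral>x. (g x - (\<integral>y. g y \<partial>P0))\<^sup>2 \<partial>P0) / 2)\<bar> \<le> err n"
          unfolding err_def V_def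
          by (rule posterior_laplace_bound[OF assms(4,5) n assms(6)[OF n elim(1)] P0 v])
            (use \<delta> small n in auto)
      qed
    qed
    show ?case
      by (rule tendsto_sandwich[OF _ ev tendsto_const lim]) simp
  qed
qed

end
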